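(* Let $p>0$ and $\alpha,\beta>0$. Let $L>0$ and $f_0\in\mathcal F^\beta(L)$, and let $X=X^{(n)}\sim P_{f_0}^{(n)}$ be generated from the Gaussian sequence model. Let $\Pi=\Pi(p,\alpha)$ be the prior on $f=(f_k)_{k\ge1}$ under which $f_k=\sigma_k\zeta_k$, with $\sigma_k=k^{-1/2-\alpha}$ and $(\zeta_k)_{k\ge 1}$ i.i.d. with a density $h$ having $p$-exponential tails. Define $$\varepsilon_n=\begin{cases} n^{-\frac{\beta}{2\beta+p(\alpha-\beta)+1}}, & \alpha>\beta,\\ n^{-\frac{\alpha}{2\alpha+1}}, & \alpha\le\beta.\end{cases}$$ Then for any $\rho\in(0,1)$ there exists a large enough constant $M>0$ such that, as $n\to\infty$, $$E_{f_0}\Pi_\rho\big[\,\|f-f_0\|_2\le M\varepsilon_n \,\big|\, X\big]\to 1 .$$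
   Context: Gaussian sequence model: functions $f\in L^2[0,1]$ are identified with their coefficient sequences $(f_k)_{k\ge1}$ in a fixed orthonormal basis of $L^2[0,1]$, so $\|f\|_2^2=\sum_k f_k^2$. For $n\ge1$, $P_f^{(n)}$ is the law of $X=(X_k)_{k\ge1}$ with $X_k=f_k+n^{-1/2}\xi_k$, $\xi_k$ i.i.d. $\mathcal N(0,1)$. $E_{f_0}$ is expectation under $P_{f_0}^{(n)}$. $\rho$-posterior: for a prior $\Pi$ and $\rho\in(0,1]$, $\Pi_\rho[B\mid X]=\int_B e^{\rho\ell_n(f,X)}d\Pi(f)\big/\int e^{\rho\ell_n(f,X)}d\Pi(f)$, where $\ell_n(f,X)=-\frac n2\sum_k(X_k-f_k)^2$, understood up to an additive term not depending on $f$, i.e. as $n\sum_k X_kf_k-\frac n2\sum_k f_k^2$ (log-density with respect to $P_0^{(n)}$). Hyperrectangle: $\mathcal F^\beta(L)=\{f=(f_k):\ \max_{k\ge1}|f_k|k^{\beta+1/2}\le L\}$. $p$-exponential tails: a probability density $h$ on $\mathbb R$ has $p$-exponential tails if it is symmetric about $0$; there are constants $c_0,c_1>0$ with $h(t)\ge c_0e^{-c_1t^p}$ for all $t\ge0$; and, with $\overline H(x)=\int_x^\infty h(t)dt$, there are $q\in(0,p]$ and constants $d_0,d_1,M_0>0$ with $\overline H(x)\le d_0e^{-d_1x^q}$ for all $x\ge M_0$. *)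

theory Defs
  imports "HOL-Probability.Probability"
begin

text \<open>
  A function \<open>f\<close> in \<open>L\<^sup>2[0,1]\<close> is represented by its coefficient sequence with respect to the fixed
  orthonormal basis. The mathematical index set starts at \<open>1\<close>; the coefficient \<open>f\<^sub>k\<close> is stored
  at position \<open>k - 1\<close>, so position \<open>i\<close> carries the index \<open>Suc i\<close> in all weights below.
\<close>

type_synonym coeffs = "nat \<Rightarrow> real"

abbreviation seq_space :: "coeffs measure" where
  "seq_space \<equiv> Pi\<^sub>M UNIV (\<lambda>_. borel)"

definition iid_seq :: "(real \<Rightarrow> real) \<Rightarrow> coeffs measure" where
  "iid_seq g = Pi\<^sub>M UNIV (\<lambda>_. density lborel (\<lambda>t. ennreal (g t)))"

definition gauss_seq_law :: "nat \<Rightarrow> coeffs \<Rightarrow> coeffs measure" where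
  "gauss_seq_law n f =
     distr (iid_seq std_normal_density) seq_space (\<lambda>\<xi> i. f i + \<xi> i / sqrt (real n))"

definition prior_scale :: "real \<Rightarrow> nat \<Rightarrow> real" where
  "prior_scale \<alpha> i = real (Suc i) powr (- 1 / 2 - \<alpha>)"

definition series_prior :: "real \<Rightarrow> (real \<Rightarrow> real) \<Rightarrow> coeffs measure" where
  "series_prior \<alpha> h = distr (iid_seq h) seq_space (\<lambda>\<zeta> i. prior_scale \<alpha> i * \<zeta> i)"

text \<open>
  Log-density with respect to the law at \<open>f = 0\<close>. The first series converges in general only
  conditionally, hence the sum is the limit of partial sums. It converges for almost every \<open>X\<close>
  when \<open>f\<close> is square summable; where a series diverges the value is arbitrary.
\<close>

definition log_lik :: "nat \<Rightarrow> coeffs \<Rightarrow> coeffs \<Rightarrow> real" where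
  "log_lik n f X = real n * (\<Sum>i. X i * f i) - real n / 2 * (\<Sum>i. (f i)\<^sup>2)"

definition rho_posterior :: "coeffs measure \<Rightarrow> nat \<Rightarrow> real \<Rightarrow> coeffs \<Rightarrow> coeffs set \<Rightarrow> real" where
  "rho_posterior prior n \<rho> X B =
     (LINT f:B|prior. exp (\<rho> * log_lik n f X)) / (LINT f|prior. exp (\<rho> * log_lik n f X))"

text \<open>
  The summability clause is needed because \<open>suminf\<close> is unspecified on divergent series:
  a sequence at infinite distance from \<open>f\<^sub>0\<close> does not belong to the ball.
\<close>

definition l2_cball :: "coeffs \<Rightarrow> real \<Rightarrow> coeffs set" where
  "l2_cball f\<^sub>0 r =
     {f. summable (\<lambda>i. (f i - f\<^sub>0 i)\<^sup>2) \<and> sqrt (\<Sum>i. (f i - f\<^sub>0 i)\<^sup>2) \<le> r}"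

definition hyperrectangle :: "real \<Rightarrow> real \<Rightarrow> coeffs set" where
  "hyperrectangle \<beta> L = {f. \<forall>i. \<bar>f i\<bar> * real (Suc i) powr (\<beta> + 1 / 2) \<le> L}"

definition prob_density :: "(real \<Rightarrow> real) \<Rightarrow> bool" where
  "prob_density h \<longleftrightarrow>
     h \<in> borel_measurable borel \<and> (\<forall>t. 0 \<le> h t) \<and> (\<integral>\<^sup>+ t. ennreal (h t) \<partial>lborel) = 1"

definition exp_tails :: "real \<Rightarrow> (real \<Rightarrow> real) \<Rightarrow> bool" where
  "exp_tails p h \<longleftrightarrow>
     (\<forall>t. h (- t) = h t) \<and>
     (\<exists>c\<^sub>0>0. \<exists>c\<^sub>1>0. \<forall>t\<ge>0. h t \<ge> c\<^sub>0 * exp (- c\<^sub>1 * t powr p)) \<and>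
     (\<exists>q. 0 < q \<and> q \<le> p \<and>
        (\<exists>d\<^sub>0>0. \<exists>d\<^sub>1>0. \<exists>M\<^sub>0>0. \<forall>x\<ge>M\<^sub>0.
           (LINT t:{x..}|lborel. h t) \<le> d\<^sub>0 * exp (- d\<^sub>1 * x powr q)))"

definition rate :: "real \<Rightarrow> real \<Rightarrow> real \<Rightarrow> nat \<Rightarrow> real" where
  "rate p \<alpha> \<beta> n =
     (if \<alpha> > \<beta> then real n powr (- (\<beta> / (2 * \<beta> + p * (\<alpha> - \<beta>) + 1)))
      else real n powr (- (\<alpha> / (2 * \<alpha> + 1))))"

end

theory Submission
  imports Defs "HOL-Real_Asymp.Real_Asymp"
begin

text \<open>
  Write \<open>G\<close> for the \<open>\<rho>\<close>-th power of the likelihood ratio of \<open>f\<close> against \<open>f\<^sub>0\<close>. Its expectation under \<open>f\<^sub>0\<close> is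
  at most \<open>exp (- \<rho> (1 - \<rho>) n |f - f\<^sub>0|\<^sup>2 / 2)\<close>, and that of \<open>1 / G\<close> is at most \<open>exp (\<rho> (1 + \<rho>) n |f - f\<^sub>0|\<^sup>2 / 2)\<close>.
  The posterior mass of the complement of a ball is a ratio \<open>u / d \<le> 1\<close>, hence at most its own square
  root and so at most \<open>(t u + 1 / (t d)) / 2\<close> for every \<open>t > 0\<close>. Cauchy-Schwarz bounds \<open>1 / d\<close> by an average
  of \<open>1 / G\<close> over a small ball around \<open>f\<^sub>0\<close>, so only first moments of \<open>G\<close> and \<open>1 / G\<close> enter and
  everything reduces to a lower bound \<open>exp (- C n \<epsilon>\<^sup>2)\<close> for the prior mass of that ball.

  For the prior mass, cut at \<open>K\<close> of order \<open>n powr r\<close> with \<open>r = 1 / (2 min \<alpha> \<beta> + p max (\<alpha> - \<beta>) 0 + 1)\<close>. Each of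
  the first \<open>K\<close> coordinates \<open>\<zeta>\<^sub>k\<close> is asked to lie within \<open>(k / K) powr (1 / 2 + \<alpha>)\<close> of \<open>f\<^sub>0\<^sub>k / \<sigma>\<^sub>k\<close>, which costs a
  factor \<open>exp (- C K powr (1 + p max (\<alpha> - \<beta>) 0))\<close> by the lower tail bound on the density; the remaining
  coordinates are controlled by Markov's inequality.
\<close>

section \<open>Random series with independent coefficients\<close>

text \<open>One setting for both the noise and the coefficients of the prior: \<open>S\<close> is
  the infinite product of \<open>M\<close>, and \<open>sets_M\<close> lets Borel functions act on
  single coordinates when \<open>M\<close> is given by a density.\<close>

locale real_sequence_space = sequence_space M for M :: "real measure" +
  assumes sets_M [measurable_cong]: "sets M = sets borel"
begin

lemma nn_integral_S_iter:
  assumes [measurable]: "f \<in> borel_measurable S"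
  shows "(\<integral>\<^sup>+ \<omega>. f \<omega> \<partial>S) = (\<integral>\<^sup>+ x. \<integral>\<^sup>+ \<omega>. f (case_nat x \<omega>) \<partial>S \<partial>M)"
proof -
  have "(\<integral>\<^sup>+ \<omega>. f \<omega> \<partial>S) = (\<integral>\<^sup>+ \<omega>. f \<omega> \<partial>distr (M \<Otimes>\<^sub>M S) S (\<lambda>(s, \<omega>). case_nat s \<omega>))"
    by (simp only: PiM_iter)
  also have "\<dots> = (\<integral>\<^sup>+ z. f (case_nat (fst z) (snd z)) \<partial>(M \<Otimes>\<^sub>M S))"
    by (subst nn_integral_distr) (simp_all add: case_prod_beta)
  also have "\<dots> = (\<integral>\<^sup>+ x. \<integral>\<^sup>+ \<omega>. f (case_nat x \<omega>) \<partial>S \<partial>M)"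
    by (subst P.nn_integral_fst[symmetric]) simp_all
  finally show ?thesis .
qed

lemma nn_integral_S_prod:
  assumes "\<And>i. g i \<in> borel_measurable borel"
  shows "(\<integral>\<^sup>+ \<omega>. (\<Prod>i<n. g i (\<omega> i)) \<partial>S) = (\<Prod>i<n. \<integral>\<^sup>+ x. g i x \<partial>M)"
  using assms
proof (induction n arbitrary: g)
  case 0
  then show ?case by (simp add: P.emeasure_space_1)
next
  case (Suc n)
  note [measurable] = Suc.prems
  have "(\<integral>\<^sup>+ \<omega>. (\<Prod>i<Suc n. g i (\<omega> i)) \<partial>S)
      = (\<integral>\<^sup>+ x. \<integral>\<^sup>+ \<omega>. g 0 x * (\<Prod>i<n. g (Suc i) (\<omega> i)) \<partial>S \<partial>M)"
    by (subst nn_integral_S_iter) (simp_all del: prod.lessThan_Suc add: prod.lessThan_Suc_shift)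
  also have "\<dots> = (\<integral>\<^sup>+ x. g 0 x * (\<Prod>i<n. \<integral>\<^sup>+ x. g (Suc i) x \<partial>M) \<partial>M)"
    using Suc.IH[of "\<lambda>i. g (Suc i)"] by (subst nn_integral_cmult) simp_all
  also have "\<dots> = (\<Prod>i<Suc n. \<integral>\<^sup>+ x. g i x \<partial>M)"
    by (subst nn_integral_multc) (simp_all del: prod.lessThan_Suc add: prod.lessThan_Suc_shift)
  finally show ?case .
qed

lemma nn_integral_S_component:
  assumes "g \<in> borel_measurable borel"
  shows "(\<integral>\<^sup>+ \<omega>. g (\<omega> i) \<partial>S) = (\<integral>\<^sup>+ x. g x \<partial>M)"
  using nn_integral_S_prod[of "\<lambda>j. if j = i then g else (\<lambda>_. 1)" "Suc i"] assms
  by (simp add: M.emeasure_space_1)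

text \<open>Kolmogorov's maximal inequality; \<open>mom\<close> encodes mean zero and variance one.
  The free starting value \<open>y\<close> makes the induction work: if \<open>\<bar>y\<bar>\<close>
  reaches \<open>t\<close> the bound exceeds 1, and otherwise the walk restarts from
  \<open>y + a 0 * x\<close>, whose mean square is given by \<open>mom\<close>.\<close>

lemma maximal_ineq:
  fixes a :: "nat \<Rightarrow> real"
  assumes mom: "\<And>y b. (\<integral>\<^sup>+ x. ennreal ((y + b * x)\<^sup>2) \<partial>M) = ennreal (y\<^sup>2 + b\<^sup>2)"
    and "t > 0"
  shows "(\<integral>\<^sup>+ \<omega>. (if \<exists>k\<le>n. t \<le> \<bar>y + (\<Sum>j<k. a j * \<omega> j)\<bar> then 1 else 0) \<partial>S)
     \<le> ennreal ((y\<^sup>2 + (\<Sum>j<n. (a j)\<^sup>2)) / t\<^sup>2)"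
proof (induction n arbitrary: y a)
  case 0
  have "t\<^sup>2 \<le> y\<^sup>2" if "t \<le> \<bar>y\<bar>"
    using that \<open>t > 0\<close> by (metis abs_le_square_iff abs_of_pos)
  then show ?case
    using \<open>t > 0\<close> by (simp add: P.emeasure_space_1)
next
  case (Suc n)
  show ?case
  proof (cases "t \<le> \<bar>y\<bar>")
    case True
    have "t\<^sup>2 \<le> y\<^sup>2"
      using True \<open>t > 0\<close> by (metis abs_le_square_iff abs_of_pos)
    then have "1 \<le> (y\<^sup>2 + (\<Sum>j<Suc n. (a j)\<^sup>2)) / t\<^sup>2"
      using \<open>t > 0\<close> sum_nonneg[of "{..<Suc n}" "\<lambda>j. (a j)\<^sup>2"] by (simp add: field_simps)
    moreover have "(\<integral>\<^sup>+ \<omega>. (if \<exists>k\<le>Suc n. t \<le> \<bar>y + (\<Sum>j<k. a j * \<omega> j)\<bar> then 1 else 0) \<partial>S)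
      \<le> (\<integral>\<^sup>+ \<omega>. 1 \<partial>S)"
      by (intro nn_integral_mono) auto
    ultimately show ?thesis
      by (simp add: P.emeasure_space_1 order_trans)
  next
    case False
    \<comment> \<open>Since \<open>\<bar>y\<bar> < t\<close>, the index 0 is no witness; the
      remaining indices are those of the walk that starts after the first coordinate.\<close>
    have ex: "(\<exists>k\<le>Suc n. t \<le> \<bar>y + (\<Sum>j<k. a j * case_nat x \<omega> j)\<bar>) \<longleftrightarrow>
        (\<exists>k\<le>n. t \<le> \<bar>(y + a 0 * x) + (\<Sum>j<k. a (Suc j) * \<omega> j)\<bar>)" for x \<omega>
    proof -
      have "(\<exists>k\<le>Suc n. Q k) \<longleftrightarrow> Q 0 \<or> (\<exists>k\<le>n. Q (Suc k))" for Q
        by (metis Suc_le_mono le0 not0_implies_Suc)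
      from this[of "\<lambda>k. t \<le> \<bar>y + (\<Sum>j<k. a j * case_nat x \<omega> j)\<bar>"] False show ?thesis
        by (simp del: sum.lessThan_Suc add: sum.lessThan_Suc_shift add.assoc)
    qed
    have "(\<integral>\<^sup>+ \<omega>. (if \<exists>k\<le>Suc n. t \<le> \<bar>y + (\<Sum>j<k. a j * \<omega> j)\<bar> then 1 else 0) \<partial>S)
      = (\<integral>\<^sup>+ x. \<integral>\<^sup>+ \<omega>. (if \<exists>k\<le>n. t \<le> \<bar>(y + a 0 * x) + (\<Sum>j<k. a (Suc j) * \<omega> j)\<bar> then 1 else 0) \<partial>S \<partial>M)"
      by (subst nn_integral_S_iter) (simp_all only: ex, measurable)
    also have "\<dots> \<le> (\<integral>\<^sup>+ x. ennreal (((y + a 0 * x)\<^sup>2 + (\<Sum>j<n. (a (Suc j))\<^sup>2)) / t\<^sup>2) \<partial>M)"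
      by (intro nn_integral_mono Suc)
    also have "\<dots> = (\<integral>\<^sup>+ x. ennreal (1 / t\<^sup>2) * (ennreal ((y + a 0 * x)\<^sup>2) + ennreal (\<Sum>j<n. (a (Suc j))\<^sup>2)) \<partial>M)"
      by (intro nn_integral_cong) (simp add: sum_nonneg flip: ennreal_plus ennreal_mult)
    also have "\<dots> = ennreal (1 / t\<^sup>2) * (ennreal (y\<^sup>2 + (a 0)\<^sup>2) + ennreal (\<Sum>j<n. (a (Suc j))\<^sup>2))"
      by (simp add: nn_integral_cmult nn_integral_add mom M.emeasure_space_1)
    also have "\<dots> = ennreal ((y\<^sup>2 + (\<Sum>j<Suc n. (a j)\<^sup>2)) / t\<^sup>2)"
      by (simp add: sum_nonneg sum.lessThan_Suc_shift add.assoc del: sum.lessThan_Suc flip: ennreal_plus ennreal_mult)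
    finally show ?thesis .
  qed
qed

text \<open>Setting the first \<open>m\<close> coefficients to zero turns the maximal inequality for partial sums
  into one for their oscillation after \<open>m\<close>.\<close>

lemma AE_summable:
  fixes a :: "nat \<Rightarrow> real"
  assumes mom: "\<And>y b. (\<integral>\<^sup>+ x. ennreal ((y + b * x)\<^sup>2) \<partial>M) = ennreal (y\<^sup>2 + b\<^sup>2)"
    and sm: "summable (\<lambda>i. (a i)\<^sup>2)"
  shows "AE \<omega> in S. summable (\<lambda>i. a i * \<omega> i)"
proof -
  define P where "P t m k \<omega> \<longleftrightarrow> t \<le> \<bar>\<Sum>j\<in>{m..<k}. a j * \<omega> j\<bar>" for t :: real and m k \<omega>
  have [measurable]: "Measurable.pred S (P t m k)" for t m k
    unfolding P_def by measurable
  have osc: "emeasure S {\<omega>\<in>space S. \<exists>k. P t m k \<omega>} \<le> ennreal ((\<Sum>j. (a (j + m))\<^sup>2) / t\<^sup>2)"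
    if "t > 0" for t m
  proof -
    define b where "b j = (if j < m then 0 else a j)" for j
    have bsum: "(\<Sum>j<k. b j * \<omega> j) = (\<Sum>j\<in>{m..<k}. a j * \<omega> j)" for k \<omega>
    proof -
      have "(\<Sum>j<k. b j * \<omega> j) = (\<Sum>j<k. if j \<in> {m..<k} then a j * \<omega> j else 0)"
        by (intro sum.cong) (auto simp: b_def)
      also have "\<dots> = (\<Sum>j\<in>{m..<k}. a j * \<omega> j)"
        by (subst sum.inter_restrict[symmetric]) (auto intro!: sum.cong)
      finally show ?thesis .
    qed
    have bsq: "(\<Sum>j<n. (b j)\<^sup>2) \<le> (\<Sum>j. (a (j + m))\<^sup>2)" for n
    proof -
      have "(\<Sum>j<n. (b j)\<^sup>2) \<le> (\<Sum>j<n + m. (b j)\<^sup>2)"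
        by (intro sum_mono2) auto
      also have "\<dots> = (\<Sum>j<m. (b j)\<^sup>2) + (\<Sum>j<n. (b (m + j))\<^sup>2)"
        by (induction n) (simp_all add: add.commute)
      also have "\<dots> = (\<Sum>j<n. (a (j + m))\<^sup>2)"
        by (simp add: b_def add.commute)
      also have "\<dots> \<le> (\<Sum>j. (a (j + m))\<^sup>2)"
        using summable_ignore_initial_segment[OF sm] by (intro sum_le_suminf) simp_all
      finally show ?thesis .
    qed
    have fin: "emeasure S {\<omega>\<in>space S. \<exists>k\<le>n. P t m k \<omega>} \<le> ennreal ((\<Sum>j. (a (j + m))\<^sup>2) / t\<^sup>2)" for n
    proof -
      have "emeasure S {\<omega>\<in>space S. \<exists>k\<le>n. P t m k \<omega>} = (\<integral>\<^sup>+ \<omega>. indicator {\<omega>\<in>space S. \<exists>k\<le>n. P t m k \<omega>} \<omega> \<partial>S)"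
        by (intro nn_integral_indicator[symmetric]) measurable
      also have "\<dots> = (\<integral>\<^sup>+ \<omega>. (if \<exists>k\<le>n. t \<le> \<bar>0 + (\<Sum>j<k. b j * \<omega> j)\<bar> then 1 else 0) \<partial>S)"
        unfolding bsum by (intro nn_integral_cong) (auto simp: P_def indicator_def)
      also have "\<dots> \<le> ennreal ((0\<^sup>2 + (\<Sum>j<n. (b j)\<^sup>2)) / t\<^sup>2)"
        by (intro maximal_ineq mom that)
      also have "\<dots> \<le> ennreal ((\<Sum>j. (a (j + m))\<^sup>2) / t\<^sup>2)"
        using bsq[of n] by (intro ennreal_leI divide_right_mono) auto
      finally show ?thesis .
    qed
    have "emeasure S {\<omega>\<in>space S. \<exists>k. P t m k \<omega>} = emeasure S (\<Union>n. {\<omega>\<in>space S. \<exists>k\<le>n. P t m k \<omega>})"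
      by (intro arg_cong[where f = "emeasure S"]) auto
    also have "\<dots> = (SUP n. emeasure S {\<omega>\<in>space S. \<exists>k\<le>n. P t m k \<omega>})"
      by (intro SUP_emeasure_incseq[symmetric]) (auto simp: incseq_def intro: order_trans)
    also have "\<dots> \<le> ennreal ((\<Sum>j. (a (j + m))\<^sup>2) / t\<^sup>2)"
      by (intro SUP_least fin)
    finally show ?thesis .
  qed
  \<comment> \<open>A point that oscillates by \<open>t\<close> after every \<open>m\<close> lies in
    all the events of \<open>osc\<close>, whose bounds are tails of a convergent series and tend to
    0.\<close>
  have null: "AE \<omega> in S. \<exists>m. \<forall>k. \<not> P t m k \<omega>" if "t > 0" for t
  proof -
    have "emeasure S {\<omega>\<in>space S. \<forall>m. \<exists>k. P t m k \<omega>} \<le> ennreal ((\<Sum>j. (a (j + m))\<^sup>2) / t\<^sup>2)" for m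
      by (rule order_trans[OF emeasure_mono osc[OF that]]) auto
    moreover have "(\<lambda>m. ennreal ((\<Sum>j. (a (j + m))\<^sup>2) / t\<^sup>2)) \<longlonglongrightarrow> ennreal (0 / t\<^sup>2)"
      using suminf_exist_split2[OF sm] that by (intro tendsto_ennrealI tendsto_divide) auto
    ultimately have "emeasure S {\<omega>\<in>space S. \<forall>m. \<exists>k. P t m k \<omega>} \<le> ennreal (0 / t\<^sup>2)"
      by (intro LIMSEQ_le_const) auto
    then have "emeasure S {\<omega>\<in>space S. \<forall>m. \<exists>k. P t m k \<omega>} = 0"
      by simp
    then show ?thesis
      by (subst AE_iff_measurable[OF _ refl]) auto
  qed
  have "AE \<omega> in S. \<forall>l. \<exists>m. \<forall>k. \<not> P (1 / real (Suc l)) m k \<omega>"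
    using null by (simp add: AE_all_countable)
  then show ?thesis
  proof eventually_elim
    fix \<omega> assume *: "\<forall>l. \<exists>m. \<forall>k. \<not> P (1 / real (Suc l)) m k \<omega>"
    show "summable (\<lambda>i. a i * \<omega> i)"
      unfolding summable_Cauchy
    proof (intro allI impI)
      fix e :: real assume "e > 0"
      \<comment> \<open>Half of \<open>e\<close> suffices: a block that starts beyond
        \<open>N\<close> is the difference of two blocks that start at \<open>N\<close>. Only the
        countably many thresholds \<open>1 / real (Suc l)\<close> are used, so one null set serves
        all \<open>e\<close>.\<close>
      then obtain l where l: "1 / real (Suc l) < e / 2"
        using nat_approx_posE[of "e / 2"] by auto
      obtain N where N: "\<And>k. \<bar>\<Sum>j\<in>{N..<k}. a j * \<omega> j\<bar> < 1 / real (Suc l)"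
        using * by (auto simp: P_def not_le)
      have "norm (sum (\<lambda>i. a i * \<omega> i) {m..<n}) < e" if "m \<ge> N" for m n
      proof (cases "m \<le> n")
        case True
        have "sum (\<lambda>i. a i * \<omega> i) {N..<m} + sum (\<lambda>i. a i * \<omega> i) {m..<n} = sum (\<lambda>i. a i * \<omega> i) {N..<n}"
          using True that by (intro sum.atLeastLessThan_concat)
        then show ?thesis
          using N[of m] N[of n] l by simp
      qed (use \<open>e > 0\<close> in simp)
      then show "\<exists>N. \<forall>m\<ge>N. \<forall>n. norm (sum (\<lambda>i. a i * \<omega> i) {m..<n}) < e"
        by blast
    qed
  qed
qed

end

section \<open>Gaussian noise: moments and Laplace transforms of linear functionals\<close>

lemma std_normal_square_moment:
  "(\<integral>\<^sup>+ x. ennreal ((y + b * x)\<^sup>2) \<partial>density lborel std_normal_density) = ennreal (y\<^sup>2 + b\<^sup>2)"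
proof -
  have "has_bochner_integral lborel
      (\<lambda>x. y\<^sup>2 * (std_normal_density x * x ^ (2 * 0)) + 2 * y * b * (std_normal_density x * x ^ (2 * 0 + 1))
        + b\<^sup>2 * (std_normal_density x * x ^ (2 * 1)))
      (y\<^sup>2 * (fact (2 * 0) / (2 ^ 0 * fact 0)) + 2 * y * b * 0 + b\<^sup>2 * (fact (2 * 1) / (2 ^ 1 * fact 1)))"
    by (intro has_bochner_integral_add has_bochner_integral_mult_right
        std_normal_moment_even std_normal_moment_odd)
  also have "(\<lambda>x. y\<^sup>2 * (std_normal_density x * x ^ (2 * 0)) + 2 * y * b * (std_normal_density x * x ^ (2 * 0 + 1))
        + b\<^sup>2 * (std_normal_density x * x ^ (2 * 1))) = (\<lambda>x. std_normal_density x * (y + b * x)\<^sup>2)"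
    by (simp add: fun_eq_iff power2_eq_square algebra_simps)
  finally have hb: "has_bochner_integral lborel (\<lambda>x. std_normal_density x * (y + b * x)\<^sup>2) (y\<^sup>2 + b\<^sup>2)"
    by simp
  have "(\<integral>\<^sup>+ x. ennreal ((y + b * x)\<^sup>2) \<partial>density lborel std_normal_density)
      = (\<integral>\<^sup>+ x. ennreal (std_normal_density x * (y + b * x)\<^sup>2) \<partial>lborel)"
    by (subst nn_integral_density) (simp_all add: ennreal_mult)
  also have "\<dots> = ennreal (y\<^sup>2 + b\<^sup>2)"
    using hb by (subst nn_integral_eq_integral)
      (auto simp: has_bochner_integral_iff)
  finally show ?thesis .
qed

text \<open>Completing the square: tilting the standard normal density by \<open>exp (b * x)\<close>
  gives \<open>exp (b\<^sup>2 / 2)\<close> times the normal density with mean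
  \<open>b\<close>.\<close>

lemma std_normal_exp_moment:
  "(\<integral>\<^sup>+ x. ennreal (exp (b * x)) \<partial>density lborel std_normal_density) = ennreal (exp (b\<^sup>2 / 2))"
proof -
  have "std_normal_density x * exp (b * x) = exp (b\<^sup>2 / 2) * normal_density b 1 x" for x
    by (simp add: normal_density_def field_simps power2_eq_square flip: exp_add)
  then have "(\<integral>\<^sup>+ x. ennreal (exp (b * x)) \<partial>density lborel std_normal_density)
      = (\<integral>\<^sup>+ x. ennreal (exp (b\<^sup>2 / 2) * normal_density b 1 x) \<partial>lborel)"
    by (subst nn_integral_density) (simp_all flip: ennreal_mult)
  also have "\<dots> = ennreal (exp (b\<^sup>2 / 2))"
    by (subst nn_integral_eq_integral) auto
  finally show ?thesis .
qed

lemma real_sequence_space_density: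
  assumes "prob_density g"
  shows "real_sequence_space (density lborel g)"
proof -
  have "prob_space (density lborel g)"
    using assms by (intro prob_spaceI) (simp add: prob_density_def emeasure_density)
  then show ?thesis
    by (simp add: real_sequence_space_def sequence_space_def real_sequence_space_axioms_def product_prob_spaceI)
qed

lemma prob_density_std_normal: "prob_density std_normal_density"
  by (auto simp: prob_density_def nn_integral_eq_integral)

interpretation gauss: real_sequence_space "density lborel std_normal_density"
  by (rule real_sequence_space_density[OF prob_density_std_normal])

lemma gauss_AE_summable:
  assumes "summable (\<lambda>i. (b i)\<^sup>2)"
  shows "AE \<omega> in iid_seq std_normal_density. summable (\<lambda>i. b i * \<omega> i)"
  unfolding iid_seq_def by (intro gauss.AE_summable std_normal_square_moment assms)

text \<open>Independence gives the exact value for partial sums, and Fatou's lemma passes to the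
  series; only the upper bound is used later.\<close>

lemma gauss_exp_moment_le:
  assumes "summable (\<lambda>i. (b i)\<^sup>2)"
  shows "(\<integral>\<^sup>+ \<omega>. ennreal (exp (\<Sum>i. b i * \<omega> i)) \<partial>iid_seq std_normal_density) \<le> ennreal (exp ((\<Sum>i. (b i)\<^sup>2) / 2))"
proof -
  have "(\<integral>\<^sup>+ \<omega>. ennreal (exp (\<Sum>i<n. b i * \<omega> i)) \<partial>iid_seq std_normal_density) = ennreal (exp (\<Sum>i<n. (b i)\<^sup>2 / 2))" for n
    using gauss.nn_integral_S_prod[of "\<lambda>i x. ennreal (exp (b i * x))" n]
    by (simp add: iid_seq_def exp_sum prod_ennreal std_normal_exp_moment)
  moreover have "exp (\<Sum>i<n. (b i)\<^sup>2 / 2) \<le> exp ((\<Sum>i. (b i)\<^sup>2) / 2)" for n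
    using sum_le_suminf[OF assms, of "{..<n}"] by (simp flip: sum_divide_distrib)
  ultimately have fin: "(\<integral>\<^sup>+ \<omega>. ennreal (exp (\<Sum>i<n. b i * \<omega> i)) \<partial>iid_seq std_normal_density) \<le> ennreal (exp ((\<Sum>i. (b i)\<^sup>2) / 2))" for n
    by simp
  \<comment> \<open>The two integrands agree only almost everywhere: where the series diverges, its
    \<open>suminf\<close> is an unspecified value.\<close>
  have "(\<integral>\<^sup>+ \<omega>. ennreal (exp (\<Sum>i. b i * \<omega> i)) \<partial>iid_seq std_normal_density)
     = (\<integral>\<^sup>+ \<omega>. liminf (\<lambda>n. ennreal (exp (\<Sum>i<n. b i * \<omega> i))) \<partial>iid_seq std_normal_density)"
  proof (intro nn_integral_cong_AE)
    show "AE \<omega> in iid_seq std_normal_density. ennreal (exp (\<Sum>i. b i * \<omega> i)) = liminf (\<lambda>n. ennreal (exp (\<Sum>i<n. b i * \<omega> i)))"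
      using gauss_AE_summable[OF assms]
    proof eventually_elim
      case (elim \<omega>)
      then have "(\<lambda>n. ennreal (exp (\<Sum>i<n. b i * \<omega> i))) \<longlonglongrightarrow> ennreal (exp (\<Sum>i. b i * \<omega> i))"
        by (intro tendsto_ennrealI tendsto_exp summable_LIMSEQ)
      then show ?case
        by (metis lim_imp_Liminf trivial_limit_sequentially)
    qed
  qed
  also have "\<dots> \<le> liminf (\<lambda>n. \<integral>\<^sup>+ \<omega>. ennreal (exp (\<Sum>i<n. b i * \<omega> i)) \<partial>iid_seq std_normal_density)"
    unfolding iid_seq_def by (intro nn_integral_liminf) measurable
  also have "\<dots> \<le> ennreal (exp ((\<Sum>i. (b i)\<^sup>2) / 2))"
    by (intro Liminf_le) (use fin in auto)
  finally show ?thesis .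
qed

section \<open>Contraction of tempered posteriors\<close>

text \<open>Cauchy-Schwarz for \<open>sqrt (g x)\<close> and \<open>1 / sqrt (g x)\<close>, whose
  product is 1. It bounds the normalising constant of the posterior from below by an average of
  inverse likelihood ratios.\<close>

lemma nn_integral_inverse_ge:
  assumes [measurable]: "g \<in> borel_measurable P" "B \<in> sets P" and pos: "\<And>x. 0 < (g x :: real)"
  shows "(emeasure P B)\<^sup>2 \<le> (\<integral>\<^sup>+ x\<in>B. ennreal (g x) \<partial>P) * (\<integral>\<^sup>+ x\<in>B. ennreal (1 / g x) \<partial>P)"
proof -
  have *: "ennreal (sqrt (g x)) * ennreal (1 / sqrt (g x)) = 1" "(ennreal (sqrt (g x)))\<^sup>2 = ennreal (g x)"
     "(ennreal (1 / sqrt (g x)))\<^sup>2 = ennreal (1 / g x)" for x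
    using pos[of x] by (simp_all add: ennreal_power power_divide less_imp_le less_imp_neq[symmetric] flip: ennreal_mult)
  have "emeasure P B = (\<integral>\<^sup>+ x. (ennreal (sqrt (g x)) * indicator B x) * (ennreal (1 / sqrt (g x)) * indicator B x) \<partial>P)"
    by (subst nn_integral_indicator[symmetric], simp)
      (intro nn_integral_cong, simp add: indicator_def *)
  also have "(\<dots>)\<^sup>2 \<le> (\<integral>\<^sup>+ x. (ennreal (sqrt (g x)) * indicator B x)\<^sup>2 \<partial>P) * (\<integral>\<^sup>+ x. (ennreal (1 / sqrt (g x)) * indicator B x)\<^sup>2 \<partial>P)"
    by (intro Cauchy_Schwarz_nn_integral) measurable
  also have "\<dots> = (\<integral>\<^sup>+ x\<in>B. ennreal (g x) \<partial>P) * (\<integral>\<^sup>+ x\<in>B. ennreal (1 / g x) \<partial>P)"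
    by (intro arg_cong2[where f = "(*)"] nn_integral_cong) (simp_all add: power_mult_distrib * indicator_def)
  finally show ?thesis .
qed

text \<open>A number in [0, 1] is at most its square root, and the arithmetic-geometric mean
  inequality gives \<open>2 * sqrt (u / d) \<le> t * u + 1 / (t * d)\<close>. Numerator and
  denominator are thereby decoupled: \<open>u\<close> and \<open>e\<close> enter linearly and can be
  averaged separately.\<close>

lemma ratio_le_weighted:
  fixes u d e t :: real
  assumes "0 \<le> u" "u \<le> d" "0 < d" "0 < t" "1 \<le> d * e"
  shows "u / d \<le> t / 2 * u + 1 / (2 * t) * e"
proof -
  have "0 \<le> (sqrt t * sqrt u - 1 / sqrt (t * d))\<^sup>2" by simp
  also have "\<dots> = t * u + 1 / (t * d) - 2 * (sqrt u / sqrt d)"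
    using assms by (simp add: power2_diff power_mult_distrib power_divide real_sqrt_mult field_simps)
  finally have 1: "2 * sqrt (u / d) \<le> t * u + 1 / (t * d)"
    by (simp add: real_sqrt_divide)
  have "u / d \<le> sqrt (u / d)"
    using assms by (intro real_le_rsqrt) (simp add: power2_eq_square mult_le_one field_simps mult_mono)
  moreover have "1 / d \<le> e"
    using assms by (simp add: field_simps)
  then have "1 / (t * d) \<le> e / t"
    using assms by (simp add: field_simps)
  \<comment> \<open>Used with \<open>q = u / d\<close>, \<open>s = sqrt (u / d)\<close>,
    \<open>v = t * u\<close>, \<open>c = 1 / (t * d)\<close> and \<open>z = e / t\<close>; over
    plain variables the claim is linear arithmetic.\<close>
  moreover have "q \<le> (v + z) / 2" if "q \<le> s" "c \<le> z" "2 * s \<le> v + c" for q s c v z :: real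
    using that by simp
  ultimately have "u / d \<le> (t * u + e / t) / 2"
    using 1 by blast
  then show ?thesis
    by (simp add: add_divide_distrib)
qed

text \<open>The abstract argument, with \<open>N\<close> the law of the noise, \<open>P\<close> the
  prior, \<open>U\<close> the ball whose posterior mass \<open>R\<close> is studied and
  \<open>B\<close> a small ball around the truth. Bounds on noise averages for fixed
  \<open>f\<close> become, by Fubini, bounds on the averages of \<open>V\<close> and
  \<open>W\<close>, and these control the average of \<open>1 - R\<close>. The weight
  \<open>t\<close> remains free.\<close>

lemma tempered_posterior_mass:
  fixes G :: "'a \<Rightarrow> 'b \<Rightarrow> real"
  assumes "prob_space N" "prob_space P"
    and G[measurable]: "(\<lambda>(x, f). G x f) \<in> borel_measurable (N \<Otimes>\<^sub>M P)"
    and pos: "\<And>x f. 0 < G x f"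
    and [measurable]: "B \<in> sets P" "U \<in> sets P"
    and G1: "AE f in P. (\<integral>\<^sup>+ x. ennreal (G x f) \<partial>N) \<le> 1"
    and Ga: "AE f in P. f \<notin> U \<longrightarrow> (\<integral>\<^sup>+ x. ennreal (G x f) \<partial>N) \<le> ennreal a"
    and Gb: "AE f in P. f \<in> B \<longrightarrow> (\<integral>\<^sup>+ x. ennreal (1 / G x f) \<partial>N) \<le> ennreal b"
    and "0 \<le> a" "0 \<le> b" "0 < t" and B: "0 < measure P B"
  defines "R \<equiv> \<lambda>x. (LINT f:U|P. G x f) / (LINT f|P. G x f)"
  shows "1 - (t * a + b / (t * measure P B)) / 2 \<le> (LINT x|N. R x)" "(LINT x|N. R x) \<le> 1"
proof -
  interpret N: prob_space N by fact
  interpret P: prob_space P by fact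
  interpret NP: pair_prob_space N P ..
  define b\<^sub>0 where "b\<^sub>0 = measure P B"
  have b0: "emeasure P B = ennreal b\<^sub>0" "b\<^sub>0 > 0"
    using B by (simp_all add: b\<^sub>0_def P.emeasure_eq_measure)
  define D where "D x = (\<integral>\<^sup>+ f. ennreal (G x f) \<partial>P)" for x
  define V where "V x = (\<integral>\<^sup>+ f. ennreal (G x f) * indicator (space P - U) f \<partial>P)" for x
  define W where "W x = (\<integral>\<^sup>+ f. ennreal (1 / G x f) * indicator B f \<partial>P)" for x
  have [measurable]: "D \<in> borel_measurable N" "V \<in> borel_measurable N" "W \<in> borel_measurable N"
    unfolding D_def V_def W_def by measurable
  have Rm [measurable]: "R \<in> borel_measurable N"
    unfolding R_def set_lebesgue_integral_def by measurable
  \<comment> \<open>Finiteness of \<open>D\<close> makes \<open>G x\<close> integrable for almost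
    every \<open>x\<close>, so that the Bochner integrals in \<open>R\<close> have their intended
    values instead of the default 0.\<close>
  have "(\<integral>\<^sup>+ x. D x \<partial>N) = (\<integral>\<^sup>+ f. \<integral>\<^sup>+ x. ennreal (G x f) \<partial>N \<partial>P)"
    unfolding D_def by (intro NP.Fubini'[symmetric]) measurable
  also have "\<dots> \<le> (\<integral>\<^sup>+ f. 1 \<partial>P)"
    by (intro nn_integral_mono_AE G1)
  finally have "(\<integral>\<^sup>+ x. D x \<partial>N) \<noteq> \<infinity>"
    by (auto simp: P.emeasure_space_1 top_unique)
  then have Dfin: "AE x in N. D x \<noteq> \<infinity>"
    by (intro nn_integral_PInf_AE) measurable
  have "(\<integral>\<^sup>+ x. V x \<partial>N) = (\<integral>\<^sup>+ f. \<integral>\<^sup>+ x. ennreal (G x f) * indicator (space P - U) f \<partial>N \<partial>P)"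
    unfolding V_def by (intro NP.Fubini'[symmetric]) measurable
  also have "\<dots> \<le> (\<integral>\<^sup>+ f. ennreal a \<partial>P)"
    using Ga by (intro nn_integral_mono_AE, eventually_elim) (auto simp: indicator_def)
  finally have V: "(\<integral>\<^sup>+ x. V x \<partial>N) \<le> ennreal a"
    by (simp add: P.emeasure_space_1)
  have "(\<integral>\<^sup>+ x. W x \<partial>N) = (\<integral>\<^sup>+ f. \<integral>\<^sup>+ x. ennreal (1 / G x f) * indicator B f \<partial>N \<partial>P)"
    unfolding W_def by (intro NP.Fubini'[symmetric]) measurable
  also have "\<dots> \<le> (\<integral>\<^sup>+ f. ennreal b * indicator B f \<partial>P)"
    using Gb by (intro nn_integral_mono_AE, eventually_elim) (auto simp: indicator_def)
  finally have W: "(\<integral>\<^sup>+ x. W x \<partial>N) \<le> ennreal (b * b\<^sub>0)"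
    using \<open>0 \<le> b\<close> b0 by (simp add: nn_integral_cmult_indicator ennreal_mult)
  \<comment> \<open>The pointwise form of the estimate: \<open>ratio_le_weighted\<close> with
    \<open>u\<close> the unnormalised mass outside \<open>U\<close>, \<open>d\<close> the
    normalising constant and \<open>e = w / b\<^sub>0\<^sup>2\<close>.\<close>
  have main: "AE x in N. 0 \<le> R x \<and> R x \<le> 1 \<and>
      ennreal (1 - R x) \<le> ennreal (t / 2) * V x + ennreal (1 / (2 * t * b\<^sub>0\<^sup>2)) * W x"
    using Dfin AE_space
  proof eventually_elim
    case (elim x)
    have Gx [measurable]: "G x \<in> borel_measurable P"
      using measurable_Pair2[OF G elim(2)] by simp
    have int: "integrable P (G x)"
      using elim(1) pos[of x] by (intro integrableI_nonneg) (auto simp: D_def less_imp_le less_top)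
    have intU: "integrable P (\<lambda>f. indicator A f * G x f)" if [measurable]: "A \<in> sets P" for A
      using integrable_mult_indicator[OF that int] by simp
    define d where "d = (LINT f|P. G x f)"
    define u where "u = (LINT f:(space P - U)|P. G x f)"
    have "d \<ge> 0" "u \<ge> 0"
      using pos[of x] by (auto simp: d_def u_def set_lebesgue_integral_def less_imp_le intro!: integral_nonneg_AE)
    have Dd: "D x = ennreal d"
      unfolding D_def d_def using int pos[of x] by (intro nn_integral_eq_integral) (auto simp: less_imp_le)
    have "(\<integral>\<^sup>+ f. ennreal (G x f) * indicator (space P - U) f \<partial>P) = (\<integral>\<^sup>+ f. ennreal (indicator (space P - U) f * G x f) \<partial>P)"
      by (intro nn_integral_cong) (auto simp: indicator_def)
    also have "\<dots> = ennreal u"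
      unfolding u_def set_lebesgue_integral_def using intU[of "space P - U"] pos[of x]
      by (subst nn_integral_eq_integral) (auto simp: less_imp_le)
    finally have Vu: "V x = ennreal u"
      by (simp add: V_def)
    \<comment> \<open>Positivity of \<open>G\<close> rules out a vanishing denominator, where
      division would return 0.\<close>
    have "d \<noteq> 0"
    proof
      assume "d = 0"
      then have "AE f in P. ennreal (G x f) = 0"
        using Dd by (simp add: D_def nn_integral_0_iff_AE)
      then have "AE f in P. False"
        by eventually_elim (metis ennreal_eq_0_iff not_le pos)
      then show False by simp
    qed
    then have "d > 0" using \<open>d \<ge> 0\<close> by simp
    have "d = (LINT f|P. indicator U f * G x f + indicator (space P - U) f * G x f)"
      unfolding d_def by (intro Bochner_Integration.integral_cong) (auto simp: indicator_def)
    also have "\<dots> = (LINT f|P. indicator U f * G x f) + (LINT f|P. indicator (space P - U) f * G x f)"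
      by (intro Bochner_Integration.integral_add intU) measurable
    finally have split: "(LINT f:U|P. G x f) + u = d"
      unfolding u_def set_lebesgue_integral_def real_scaleR_def by simp
    have U0: "(LINT f:U|P. G x f) \<ge> 0"
      using pos[of x] by (auto simp: set_lebesgue_integral_def less_imp_le intro!: integral_nonneg_AE)
    have "R x = (d - u) / d"
      using split by (simp add: R_def d_def)
    then have Rx: "1 - R x = u / d"
      using \<open>d > 0\<close> by (simp add: field_simps)
    have "u \<le> d" using split U0 by simp
    have "ennreal (1 - R x) \<le> ennreal (t / 2) * V x + ennreal (1 / (2 * t * b\<^sub>0\<^sup>2)) * W x"
    proof (cases "W x = top")
      case True
      then show ?thesis using \<open>t > 0\<close> b0 by (simp add: ennreal_mult_top)
    next
      case False
      then obtain w where w: "W x = ennreal w" "w \<ge> 0"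
        by (cases "W x") auto
      have "(emeasure P B)\<^sup>2 \<le> (\<integral>\<^sup>+ f\<in>B. ennreal (G x f) \<partial>P) * W x"
        unfolding W_def by (intro nn_integral_inverse_ge pos) measurable
      also have "\<dots> \<le> D x * W x"
        unfolding D_def by (intro mult_right_mono nn_integral_mono) (auto simp: indicator_def)
      finally have "ennreal (b\<^sub>0\<^sup>2) \<le> ennreal (d * w)"
        using w \<open>d \<ge> 0\<close> b0 by (simp add: Dd ennreal_power ennreal_mult)
      then have "b\<^sub>0\<^sup>2 \<le> d * w"
        using w \<open>d \<ge> 0\<close> by (subst (asm) ennreal_le_iff) simp_all
      then have "1 \<le> d * (w / b\<^sub>0\<^sup>2)"
        using b0 by (simp add: field_simps)
      from ratio_le_weighted[OF \<open>u \<ge> 0\<close> \<open>u \<le> d\<close> \<open>d > 0\<close> \<open>t > 0\<close> this]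
      have "1 - R x \<le> t / 2 * u + 1 / (2 * t * b\<^sub>0\<^sup>2) * w"
        by (simp add: Rx mult.assoc)
      then have "ennreal (1 - R x) \<le> ennreal (t / 2 * u + 1 / (2 * t * b\<^sub>0\<^sup>2) * w)"
        by (rule ennreal_leI)
      also have "\<dots> = ennreal (t / 2) * V x + ennreal (1 / (2 * t * b\<^sub>0\<^sup>2)) * W x"
        using \<open>u \<ge> 0\<close> w \<open>t > 0\<close> by (simp add: Vu flip: ennreal_mult ennreal_plus)
      finally show ?thesis .
    qed
    moreover have "0 \<le> R x"
      using \<open>R x = (d - u) / d\<close> \<open>u \<le> d\<close> \<open>d > 0\<close> by simp
    moreover have "0 \<le> u / d" using \<open>u \<ge> 0\<close> \<open>d > 0\<close> by simp
    ultimately show ?case using Rx by simp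
  qed
  have intR: "integrable N R"
    using main by (intro N.integrable_const_bound[of _ 1]) auto
  show "(LINT x|N. R x) \<le> 1"
    using integral_mono_AE[OF intR, of "\<lambda>_. 1"] main by (simp add: N.prob_space)
  have "ennreal (LINT x|N. 1 - R x) = (\<integral>\<^sup>+ x. ennreal (1 - R x) \<partial>N)"
    using intR main by (subst nn_integral_eq_integral) auto
  also have "\<dots> \<le> (\<integral>\<^sup>+ x. ennreal (t / 2) * V x + ennreal (1 / (2 * t * b\<^sub>0\<^sup>2)) * W x \<partial>N)"
    using main by (intro nn_integral_mono_AE) auto
  also have "\<dots> = ennreal (t / 2) * (\<integral>\<^sup>+ x. V x \<partial>N) + ennreal (1 / (2 * t * b\<^sub>0\<^sup>2)) * (\<integral>\<^sup>+ x. W x \<partial>N)"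
    by (simp add: nn_integral_add nn_integral_cmult)
  also have "\<dots> \<le> ennreal (t / 2) * ennreal a + ennreal (1 / (2 * t * b\<^sub>0\<^sup>2)) * ennreal (b * b\<^sub>0)"
    by (intro add_mono mult_left_mono V W) auto
  also have "\<dots> = ennreal (t / 2 * a + 1 / (2 * t * b\<^sub>0\<^sup>2) * (b * b\<^sub>0))"
    using \<open>0 \<le> a\<close> \<open>0 \<le> b\<close> \<open>t > 0\<close> b0 by (simp flip: ennreal_mult ennreal_plus)
  finally have "(LINT x|N. 1 - R x) \<le> t / 2 * a + 1 / (2 * t * b\<^sub>0\<^sup>2) * (b * b\<^sub>0)"
    using \<open>0 \<le> a\<close> \<open>0 \<le> b\<close> \<open>t > 0\<close> b0 by (subst (asm) ennreal_le_iff) auto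
  moreover have "(LINT x|N. 1 - R x) = 1 - (LINT x|N. R x)"
    using intR by (simp add: N.prob_space)
  \<comment> \<open>The average of \<open>W\<close> carries a factor \<open>b\<^sub>0\<close>
    because it is restricted to \<open>B\<close>; it cancels one of the two factors in the
    denominator.\<close>
  moreover have "1 / (2 * t * b\<^sub>0\<^sup>2) * (b * b\<^sub>0) = b / (t * b\<^sub>0) / 2"
    using b0 by (simp add: power2_eq_square)
  ultimately show "1 - (t * a + b / (t * measure P B)) / 2 \<le> (LINT x|N. R x)"
    by (simp add: b\<^sub>0_def add_divide_distrib)
qed

section \<open>Square-summable sequences, balls and Gaussian likelihood ratios\<close>

lemma summable_power2_add:
  fixes a b :: "nat \<Rightarrow> real"
  assumes "summable (\<lambda>i. (a i)\<^sup>2)" "summable (\<lambda>i. (b i)\<^sup>2)"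
  shows "summable (\<lambda>i. (a i + b i)\<^sup>2)"
proof (rule summable_comparison_test'[OF summable_add[OF summable_mult[OF assms(1), of 2] summable_mult[OF assms(2), of 2]]])
  show "norm ((a n + b n)\<^sup>2) \<le> 2 * (a n)\<^sup>2 + 2 * (b n)\<^sup>2" for n
  proof -
    have "(a n + b n)\<^sup>2 \<le> 2 * (a n)\<^sup>2 + 2 * (b n)\<^sup>2"
      using sum_squares_bound[of "a n" "b n"] by (simp add: power2_sum)
    then show ?thesis by simp
  qed
qed

lemma summable_mult_of_power2:
  fixes a b :: "nat \<Rightarrow> real"
  assumes "summable (\<lambda>i. (a i)\<^sup>2)" "summable (\<lambda>i. (b i)\<^sup>2)"
  shows "summable (\<lambda>i. a i * b i)"
proof (rule summable_comparison_test'[OF summable_add[OF assms]])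
  show "norm (a n * b n) \<le> (a n)\<^sup>2 + (b n)\<^sup>2" for n
  proof -
    have "2 * (\<bar>a n\<bar> * \<bar>b n\<bar>) \<le> (a n)\<^sup>2 + (b n)\<^sup>2"
      using sum_squares_bound[of "\<bar>a n\<bar>" "\<bar>b n\<bar>"] by simp
    moreover have "0 \<le> \<bar>a n\<bar> * \<bar>b n\<bar>" by simp
    ultimately show ?thesis unfolding real_norm_def abs_mult by linarith
  qed
qed

text \<open>In \<open>ennreal\<close> a divergent series of squares has the value
  \<open>top\<close>, which absorbs the summability clause. This form yields measurability of balls
  and allows termwise estimates without a separate convergence proof.\<close>

lemma l2_cball_iff:
  assumes "0 \<le> r"
  shows "f \<in> l2_cball f\<^sub>0 r \<longleftrightarrow> (\<Sum>i. ennreal ((f i - f\<^sub>0 i)\<^sup>2)) \<le> ennreal (r\<^sup>2)"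
proof (cases "summable (\<lambda>i. (f i - f\<^sub>0 i)\<^sup>2)")
  case True
  define s where "s = (\<Sum>i. (f i - f\<^sub>0 i)\<^sup>2)"
  have "(\<Sum>i. ennreal ((f i - f\<^sub>0 i)\<^sup>2)) = ennreal s"
    unfolding s_def by (intro suminf_ennreal2 True) simp
  moreover have "f \<in> l2_cball f\<^sub>0 r \<longleftrightarrow> sqrt s \<le> r"
    using True by (simp add: l2_cball_def s_def)
  moreover have "sqrt s \<le> r \<longleftrightarrow> s \<le> r\<^sup>2"
    using real_sqrt_le_iff[of s "r\<^sup>2"] assms by simp
  ultimately show ?thesis
    by (simp only: ennreal_le_iff zero_le_power2)
next
  case False
  then have "f \<notin> l2_cball f\<^sub>0 r"
    by (simp add: l2_cball_def)
  moreover have "(\<Sum>i. ennreal ((f i - f\<^sub>0 i)\<^sup>2)) = top"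
    using False summable_suminf_not_top[of "\<lambda>i. (f i - f\<^sub>0 i)\<^sup>2"] by (meson zero_le_power2)
  moreover have "\<not> top \<le> ennreal (r\<^sup>2)"
    by (simp add: top_unique)
  ultimately show ?thesis by metis
qed

lemma measurable_l2_cball:
  assumes "0 \<le> r"
  shows "l2_cball f\<^sub>0 r \<in> sets seq_space"
proof -
  have "l2_cball f\<^sub>0 r = {f \<in> space seq_space. (\<Sum>i. ennreal ((f i - f\<^sub>0 i)\<^sup>2)) \<le> ennreal (r\<^sup>2)}"
    using l2_cball_iff[OF assms] by (auto simp: space_PiM)
  also have "\<dots> \<in> sets seq_space"
    by measurable
  finally show ?thesis .
qed

lemma log_lik_measurable [measurable]:
  assumes [measurable]: "f \<in> N \<rightarrow>\<^sub>M seq_space" "X \<in> N \<rightarrow>\<^sub>M seq_space"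
  shows "(\<lambda>z. log_lik n (f z) (X z)) \<in> borel_measurable N"
proof -
  have [measurable]: "(\<lambda>z. f z i) \<in> borel_measurable N" "(\<lambda>z. X z i) \<in> borel_measurable N" for i
    using measurable_compose[OF assms(1) measurable_component_singleton[of i UNIV "\<lambda>_. borel"]]
      measurable_compose[OF assms(2) measurable_component_singleton[of i UNIV "\<lambda>_. borel"]] by auto
  show ?thesis
    unfolding log_lik_def by measurable
qed

text \<open>The observation as a function of the noise, so that expectations under
  \<open>gauss_seq_law\<close> become integrals over the fixed space of Gaussian sequences.\<close>

abbreviation obs :: "nat \<Rightarrow> coeffs \<Rightarrow> coeffs \<Rightarrow> coeffs" where
  "obs n f\<^sub>0 \<xi> \<equiv> \<lambda>i. f\<^sub>0 i + \<xi> i / sqrt (real n)"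

lemma sets_iid_seq [measurable_cong]: "sets (iid_seq g) = sets seq_space"
  unfolding iid_seq_def by (intro sets_PiM_cong) simp_all

lemma obs_measurable [measurable]: "obs n f\<^sub>0 \<in> iid_seq g \<rightarrow>\<^sub>M seq_space"
  by (intro measurable_PiM_single') (auto simp: space_PiM)

text \<open>Inserting the observation completes the square: the deterministic terms combine to the
  squared distance, and the noise enters through a series linear in \<open>\<xi>\<close>. The
  identity holds almost surely because the noise series for \<open>f\<close> and for
  \<open>f\<^sub>0\<close> have to converge before they can be split.\<close>

lemma log_lik_diff:
  assumes f0: "summable (\<lambda>i. (f\<^sub>0 i)\<^sup>2)" and d: "summable (\<lambda>i. (f i - f\<^sub>0 i)\<^sup>2)" and n: "n > 0"
  shows "AE \<xi> in iid_seq std_normal_density. log_lik n f (obs n f\<^sub>0 \<xi>) - log_lik n f\<^sub>0 (obs n f\<^sub>0 \<xi>)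
      = (\<Sum>i. (sqrt (real n) * (f i - f\<^sub>0 i)) * \<xi> i) - real n / 2 * (\<Sum>i. (f i - f\<^sub>0 i)\<^sup>2)"
proof -
  have f: "summable (\<lambda>i. (f i)\<^sup>2)"
    using summable_power2_add[OF f0 d] by simp
  note ff0 = summable_mult_of_power2[OF f0 f]
  show ?thesis
    using gauss_AE_summable[OF f0] gauss_AE_summable[OF f]
  proof eventually_elim
    case (elim \<xi>)
    have inv: "real n * (x + 1 / sqrt (real n) * y) = real n * x + sqrt (real n) * y" for x y
      using n by (simp add: distrib_left real_div_sqrt flip: times_divide_eq_left)
    have 1: "(\<lambda>i. obs n f\<^sub>0 \<xi> i * f i) sums ((\<Sum>i. f\<^sub>0 i * f i) + 1 / sqrt (real n) * (\<Sum>i. f i * \<xi> i))"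
      using sums_add[OF summable_sums[OF ff0] sums_mult[OF summable_sums[OF elim(2)], of "1 / sqrt (real n)"]]
      by (simp add: algebra_simps)
    have 2: "(\<lambda>i. obs n f\<^sub>0 \<xi> i * f\<^sub>0 i) sums ((\<Sum>i. (f\<^sub>0 i)\<^sup>2) + 1 / sqrt (real n) * (\<Sum>i. f\<^sub>0 i * \<xi> i))"
      using sums_add[OF summable_sums[OF f0] sums_mult[OF summable_sums[OF elim(1)], of "1 / sqrt (real n)"]]
      by (simp add: algebra_simps power2_eq_square)
    have 3: "(\<lambda>i. (sqrt (real n) * (f i - f\<^sub>0 i)) * \<xi> i) sums (sqrt (real n) * ((\<Sum>i. f i * \<xi> i) - (\<Sum>i. f\<^sub>0 i * \<xi> i)))"
      using sums_mult[OF sums_diff[OF summable_sums[OF elim(2)] summable_sums[OF elim(1)]], of "sqrt (real n)"]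
      by (simp add: algebra_simps)
    have 4: "(\<lambda>i. (f i - f\<^sub>0 i)\<^sup>2) sums ((\<Sum>i. (f i)\<^sup>2) + (\<Sum>i. (f\<^sub>0 i)\<^sup>2) - 2 * (\<Sum>i. f\<^sub>0 i * f i))"
      using sums_diff[OF sums_add[OF summable_sums[OF f] summable_sums[OF f0]] sums_mult[OF summable_sums[OF ff0], of 2]]
      by (simp add: power2_diff algebra_simps)
    show ?case
      unfolding log_lik_def sums_unique[OF 1, symmetric] sums_unique[OF 2, symmetric]
        sums_unique[OF 3, symmetric] sums_unique[OF 4, symmetric] inv
      by (simp add: algebra_simps)
  qed
qed

text \<open>The Gaussian exponential moment contributes \<open>s\<^sup>2\<close> and the drift
  \<open>- s\<close>. The exponent \<open>s\<close> may have either sign: \<open>s = \<rho>\<close>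
  gives decay away from \<open>f\<^sub>0\<close>, and \<open>s = - \<rho>\<close> controls the
  inverse ratio near \<open>f\<^sub>0\<close>.\<close>

lemma exp_log_lik_diff_le:
  assumes f0: "summable (\<lambda>i. (f\<^sub>0 i)\<^sup>2)" and d: "summable (\<lambda>i. (f i - f\<^sub>0 i)\<^sup>2)" and n: "n > 0"
  shows "(\<integral>\<^sup>+ \<xi>. ennreal (exp (s * (log_lik n f (obs n f\<^sub>0 \<xi>) - log_lik n f\<^sub>0 (obs n f\<^sub>0 \<xi>)))) \<partial>iid_seq std_normal_density)
    \<le> ennreal (exp ((s\<^sup>2 - s) * (real n / 2) * (\<Sum>i. (f i - f\<^sub>0 i)\<^sup>2)))"
proof -
  define \<Delta> where "\<Delta> = (\<Sum>i. (f i - f\<^sub>0 i)\<^sup>2)"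
  define b where "b i = s * sqrt (real n) * (f i - f\<^sub>0 i)" for i
  have b2: "(b i)\<^sup>2 = s\<^sup>2 * real n * (f i - f\<^sub>0 i)\<^sup>2" for i
    by (simp add: b_def power_mult_distrib)
  have sb: "summable (\<lambda>i. (b i)\<^sup>2)" "(\<Sum>i. (b i)\<^sup>2) = s\<^sup>2 * real n * \<Delta>"
    unfolding b2 \<Delta>_def using d by (simp_all add: summable_mult suminf_mult)
  have s1: "summable (\<lambda>i. ((sqrt (real n) * (f i - f\<^sub>0 i)))\<^sup>2)"
    using summable_mult[OF d, of "real n"] by (simp add: power_mult_distrib)
  have "(\<integral>\<^sup>+ \<xi>. ennreal (exp (s * (log_lik n f (obs n f\<^sub>0 \<xi>) - log_lik n f\<^sub>0 (obs n f\<^sub>0 \<xi>)))) \<partial>iid_seq std_normal_density)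
    = (\<integral>\<^sup>+ \<xi>. ennreal (exp (- s * (real n / 2) * \<Delta>)) * ennreal (exp (\<Sum>i. b i * \<xi> i)) \<partial>iid_seq std_normal_density)"
  proof (intro nn_integral_cong_AE)
    show "AE \<xi> in iid_seq std_normal_density.
      ennreal (exp (s * (log_lik n f (obs n f\<^sub>0 \<xi>) - log_lik n f\<^sub>0 (obs n f\<^sub>0 \<xi>))))
      = ennreal (exp (- s * (real n / 2) * \<Delta>)) * ennreal (exp (\<Sum>i. b i * \<xi> i))"
      using log_lik_diff[OF assms] gauss_AE_summable[OF s1]
    proof eventually_elim
      case (elim \<xi>)
      have "(\<Sum>i. b i * \<xi> i) = s * (\<Sum>i. (sqrt (real n) * (f i - f\<^sub>0 i)) * \<xi> i)"
        by (subst suminf_mult[OF elim(2), symmetric]) (simp add: b_def mult.assoc)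
      then show ?case
        unfolding elim(1) \<Delta>_def by (simp add: algebra_simps flip: ennreal_mult exp_add)
    qed
  qed
  also have "\<dots> = ennreal (exp (- s * (real n / 2) * \<Delta>)) * (\<integral>\<^sup>+ \<xi>. ennreal (exp (\<Sum>i. b i * \<xi> i)) \<partial>iid_seq std_normal_density)"
    by (intro nn_integral_cmult) measurable
  also have "\<dots> \<le> ennreal (exp (- s * (real n / 2) * \<Delta>)) * ennreal (exp ((\<Sum>i. (b i)\<^sup>2) / 2))"
    by (intro mult_left_mono gauss_exp_moment_le sb) auto
  also have "\<dots> = ennreal (exp ((s\<^sup>2 - s) * (real n / 2) * \<Delta>))"
    by (simp add: sb algebra_simps flip: ennreal_mult exp_add)
  finally show ?thesis by (simp add: \<Delta>_def)
qed

text \<open>The abstract bound for the Gaussian model, with the prior entering only through almost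
  sure square summability and the mass of the ball of radius \<open>r\<close>.\<close>

lemma rho_posterior_ball:
  assumes P: "prob_space P" and sets_P [measurable_cong]: "sets P = sets seq_space"
    and f0: "summable (\<lambda>i. (f\<^sub>0 i)\<^sup>2)" and sP: "AE f in P. summable (\<lambda>i. (f i)\<^sup>2)"
    and n: "n > 0" and \<rho>: "0 < \<rho>" "\<rho> < 1" and "0 \<le> r" "0 \<le> R" "0 < t"
    and pos: "0 < measure P (l2_cball f\<^sub>0 r)"
  defines "Q \<equiv> LINT X|gauss_seq_law n f\<^sub>0. rho_posterior P n \<rho> X (l2_cball f\<^sub>0 R)"
  shows "1 - (t * exp (- (\<rho> * (1 - \<rho>) / 2) * (real n * R\<^sup>2))
      + exp (\<rho> * (1 + \<rho>) / 2 * (real n * r\<^sup>2)) / (t * measure P (l2_cball f\<^sub>0 r))) / 2 \<le> Q"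
    and "Q \<le> 1"
proof -
  interpret P: prob_space P by fact
  define N where "N = iid_seq std_normal_density"
  have [measurable_cong]: "sets N = sets seq_space"
    by (simp add: N_def sets_iid_seq)
  have [measurable]: "obs n f\<^sub>0 \<in> N \<rightarrow>\<^sub>M seq_space"
    unfolding N_def by measurable
  define G where "G \<xi> f = exp (\<rho> * (log_lik n f (obs n f\<^sub>0 \<xi>) - log_lik n f\<^sub>0 (obs n f\<^sub>0 \<xi>)))" for \<xi> f
  have Gm: "(\<lambda>(\<xi>, f). G \<xi> f) \<in> borel_measurable (N \<Otimes>\<^sub>M P)"
  proof -
    have [measurable]: "(\<lambda>z. obs n f\<^sub>0 (fst z)) \<in> N \<Otimes>\<^sub>M P \<rightarrow>\<^sub>M seq_space"
      using measurable_compose[OF measurable_fst \<open>obs n f\<^sub>0 \<in> N \<rightarrow>\<^sub>M seq_space\<close>] .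
    have [measurable]: "(\<lambda>z. snd z) \<in> N \<Otimes>\<^sub>M P \<rightarrow>\<^sub>M seq_space"
      by measurable
    have [measurable]: "(\<lambda>z. f\<^sub>0) \<in> N \<Otimes>\<^sub>M P \<rightarrow>\<^sub>M seq_space"
      by (simp add: space_PiM)
    show ?thesis
      unfolding G_def case_prod_beta by measurable
  qed
  have bm [measurable]: "l2_cball f\<^sub>0 r \<in> sets P" "l2_cball f\<^sub>0 R \<in> sets P"
    using measurable_l2_cball[OF \<open>0 \<le> r\<close>] measurable_l2_cball[OF \<open>0 \<le> R\<close>] sets_P by auto
  have Q: "Q = (LINT \<xi>|N. (LINT f:l2_cball f\<^sub>0 R|P. G \<xi> f) / (LINT f|P. G \<xi> f))"
  proof -
    have [measurable]: "(\<lambda>X. rho_posterior P n \<rho> X (l2_cball f\<^sub>0 R)) \<in> borel_measurable seq_space"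
      unfolding rho_posterior_def set_lebesgue_integral_def by measurable
    have *: "Q = (LINT \<xi>|N. rho_posterior P n \<rho> (obs n f\<^sub>0 \<xi>) (l2_cball f\<^sub>0 R))"
      unfolding Q_def gauss_seq_law_def N_def[symmetric]
      by (intro integral_distr) measurable
    have eq: "rho_posterior P n \<rho> (obs n f\<^sub>0 \<xi>) (l2_cball f\<^sub>0 R)
        = (LINT f:l2_cball f\<^sub>0 R|P. G \<xi> f) / (LINT f|P. G \<xi> f)" for \<xi>
    proof -
      \<comment> \<open>The likelihood at \<open>f\<^sub>0\<close> is constant in \<open>f\<close>
        and cancels in the posterior ratio, which allows \<open>G\<close> to be normalised at the
        truth.\<close>
      define c where "c = exp (\<rho> * log_lik n f\<^sub>0 (obs n f\<^sub>0 \<xi>))"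
      have "c \<noteq> 0" by (simp add: c_def)
      have "exp (\<rho> * log_lik n f (obs n f\<^sub>0 \<xi>)) = c * G \<xi> f" for f
        by (simp add: c_def G_def algebra_simps flip: exp_add)
      then show ?thesis
        using \<open>c \<noteq> 0\<close> by (simp add: rho_posterior_def)
    qed
    show ?thesis
      using * unfolding eq .
  qed
  \<comment> \<open>Almost every draw is at finite distance from \<open>f\<^sub>0\<close>; lying
    outside a ball then means being far away, not that the series diverges.\<close>
  have sd: "AE f in P. summable (\<lambda>i. (f i - f\<^sub>0 i)\<^sup>2)"
    using sP by eventually_elim (use summable_power2_add[of _ "\<lambda>i. - f\<^sub>0 i"] f0 in simp)
  have "prob_space N"
    unfolding N_def iid_seq_def using gauss.P.prob_space_axioms .
  note le = exp_log_lik_diff_le[OF f0 _ n, folded N_def]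
  have G1: "AE f in P. (\<integral>\<^sup>+ \<xi>. ennreal (G \<xi> f) \<partial>N) \<le> 1"
    using sd
  proof eventually_elim
    case (elim f)
    have "(\<rho>\<^sup>2 - \<rho>) * (real n / 2) * (\<Sum>i. (f i - f\<^sub>0 i)\<^sup>2) \<le> 0"
      using \<rho> elim by (intro mult_nonpos_nonneg suminf_nonneg) (auto simp: power2_eq_square)
    then show ?case
      using le[OF elim, of \<rho>] by (simp add: G_def order_trans)
  qed
  have Ga: "AE f in P. f \<notin> l2_cball f\<^sub>0 R \<longrightarrow> (\<integral>\<^sup>+ \<xi>. ennreal (G \<xi> f) \<partial>N) \<le> ennreal (exp (- (\<rho> * (1 - \<rho>) / 2) * (real n * R\<^sup>2)))"
    using sd
  proof eventually_elim
    case (elim f)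
    show ?case
    proof
      assume "f \<notin> l2_cball f\<^sub>0 R"
      then have "R < sqrt (\<Sum>i. (f i - f\<^sub>0 i)\<^sup>2)"
        using elim by (simp add: l2_cball_def)
      then have "R\<^sup>2 \<le> (\<Sum>i. (f i - f\<^sub>0 i)\<^sup>2)"
        using power_mono[of R "sqrt (\<Sum>i. (f i - f\<^sub>0 i)\<^sup>2)" 2] \<open>0 \<le> R\<close> elim by (simp add: suminf_nonneg)
      then have "\<rho> * (1 - \<rho>) * (real n / 2) * R\<^sup>2 \<le> \<rho> * (1 - \<rho>) * (real n / 2) * (\<Sum>i. (f i - f\<^sub>0 i)\<^sup>2)"
        using \<rho> by (intro mult_left_mono) auto
      then have "exp ((\<rho>\<^sup>2 - \<rho>) * (real n / 2) * (\<Sum>i. (f i - f\<^sub>0 i)\<^sup>2)) \<le> exp (- (\<rho> * (1 - \<rho>) / 2) * (real n * R\<^sup>2))"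
        by (simp add: algebra_simps power2_eq_square)
      then show "(\<integral>\<^sup>+ \<xi>. ennreal (G \<xi> f) \<partial>N) \<le> ennreal (exp (- (\<rho> * (1 - \<rho>) / 2) * (real n * R\<^sup>2)))"
        using le[OF elim, of \<rho>] by (simp only: G_def) (meson ennreal_leI order_trans)
    qed
  qed
  have Gb: "AE f in P. f \<in> l2_cball f\<^sub>0 r \<longrightarrow> (\<integral>\<^sup>+ \<xi>. ennreal (1 / G \<xi> f) \<partial>N) \<le> ennreal (exp (\<rho> * (1 + \<rho>) / 2 * (real n * r\<^sup>2)))"
    using sd
  proof eventually_elim
    case (elim f)
    show ?case
    proof
      assume "f \<in> l2_cball f\<^sub>0 r"
      then have "sqrt (\<Sum>i. (f i - f\<^sub>0 i)\<^sup>2) \<le> r"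
        by (simp add: l2_cball_def)
      then have "(\<Sum>i. (f i - f\<^sub>0 i)\<^sup>2) \<le> r\<^sup>2"
        by (rule sqrt_le_D)
      then have "\<rho> * (1 + \<rho>) * (real n / 2) * (\<Sum>i. (f i - f\<^sub>0 i)\<^sup>2) \<le> \<rho> * (1 + \<rho>) * (real n / 2) * r\<^sup>2"
        using \<rho> by (intro mult_left_mono) auto
      then have "exp (((-\<rho>)\<^sup>2 - (-\<rho>)) * (real n / 2) * (\<Sum>i. (f i - f\<^sub>0 i)\<^sup>2)) \<le> exp (\<rho> * (1 + \<rho>) / 2 * (real n * r\<^sup>2))"
        by (simp add: algebra_simps power2_eq_square)
      moreover have "1 / G \<xi> f = exp (-\<rho> * (log_lik n f (obs n f\<^sub>0 \<xi>) - log_lik n f\<^sub>0 (obs n f\<^sub>0 \<xi>)))" for \<xi>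
        by (simp add: G_def exp_minus inverse_eq_divide)
      ultimately show "(\<integral>\<^sup>+ \<xi>. ennreal (1 / G \<xi> f) \<partial>N) \<le> ennreal (exp (\<rho> * (1 + \<rho>) / 2 * (real n * r\<^sup>2)))"
        using le[OF elim, of "-\<rho>"] by (simp only:) (meson ennreal_leI order_trans)
    qed
  qed
  note mass = tempered_posterior_mass[OF \<open>prob_space N\<close> P Gm _ bm G1 Ga Gb _ _ \<open>0 < t\<close> pos]
  show "1 - (t * exp (- (\<rho> * (1 - \<rho>) / 2) * (real n * R\<^sup>2))
      + exp (\<rho> * (1 + \<rho>) / 2 * (real n * r\<^sup>2)) / (t * measure P (l2_cball f\<^sub>0 r))) / 2 \<le> Q"
    unfolding Q by (rule mass(1)) (simp_all add: G_def)
  show "Q \<le> 1"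
    unfolding Q by (rule mass(2)) (simp_all add: G_def)
qed

section \<open>Prior mass of small balls\<close>

text \<open>On each interval from \<open>j\<close> to \<open>j + 1\<close> the square is at most
  \<open>(real j + 1)\<^sup>2\<close>, and these weights times the tail probabilities are summable
  because stretched exponential decay beats every power. Symmetry extends the bound to the negative
  half-line. The upper tail condition enters the development through this moment.\<close>

lemma exp_tails_second_moment:
  assumes h: "prob_density h" and tails: "exp_tails p h"
  shows "(\<integral>\<^sup>+ x. ennreal (x\<^sup>2) \<partial>density lborel h) < top"
proof -
  interpret real_sequence_space "density lborel h"
    by (rule real_sequence_space_density[OF h])
  define \<mu> where "\<mu> = density lborel (\<lambda>t. ennreal (h t))"
  have hm [measurable]: "h \<in> borel_measurable borel" and h0: "\<And>t. 0 \<le> h t"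
    and h1: "(\<integral>\<^sup>+ t. ennreal (h t) \<partial>lborel) = 1"
    using h by (auto simp: prob_density_def)
  have sym: "h (- t) = h t" for t
    using tails by (simp add: exp_tails_def)
  obtain q d\<^sub>0 d\<^sub>1 M\<^sub>0 where q: "0 < q" "d\<^sub>0 > 0" "d\<^sub>1 > 0"
    and tl: "\<And>x. x \<ge> M\<^sub>0 \<Longrightarrow> (LINT t:{x..}|lborel. h t) \<le> d\<^sub>0 * exp (- d\<^sub>1 * x powr q)"
    using tails unfolding exp_tails_def by blast
  have int: "integrable lborel h"
    using h0 h1 by (intro integrableI_nonneg) auto
  have meas: "measure \<mu> {x..} = (LINT t:{x..}|lborel. h t)" for x
  proof -
    have i: "integrable lborel (\<lambda>t. indicator {x..} t * h t)"
      using integrable_mult_indicator[of "{x..}" lborel h] int by simp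
    have "emeasure \<mu> {x..} = (\<integral>\<^sup>+ t. ennreal (indicator {x..} t * h t) \<partial>lborel)"
      unfolding \<mu>_def by (subst emeasure_density) (auto intro!: nn_integral_cong simp: indicator_def)
    also have "\<dots> = ennreal (LINT t:{x..}|lborel. h t)"
      unfolding set_lebesgue_integral_def using i h0 by (subst nn_integral_eq_integral) auto
    finally show ?thesis
      using h0 by (simp add: measure_def set_lebesgue_integral_def integral_nonneg_AE)
  qed
  define a where "a j = (real j + 1)\<^sup>2 * measure \<mu> {real j..}" for j
  have "summable a"
  proof (rule summable_comparison_test_ev)
    have "eventually (\<lambda>j. real j \<ge> M\<^sub>0) at_top"
      by real_asymp
    moreover have "eventually (\<lambda>j. (real j + 1)\<^sup>2 * (d\<^sub>0 * exp (- d\<^sub>1 * real j powr q)) \<le> inverse (real j ^ 2)) at_top"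
      using q by real_asymp
    ultimately show "eventually (\<lambda>j. norm (a j) \<le> inverse (real j ^ 2)) sequentially"
    proof eventually_elim
      case (elim j)
      have "a j \<le> (real j + 1)\<^sup>2 * (d\<^sub>0 * exp (- d\<^sub>1 * real j powr q))"
        unfolding a_def meas using tl[OF elim(1)] by (intro mult_left_mono) auto
      also note elim(2)
      finally show ?case by (simp add: a_def)
    qed
    show "summable (\<lambda>j. inverse (real j ^ 2))"
      by (rule inverse_power_summable) simp
  qed
  have "(\<integral>\<^sup>+ x. ennreal (x\<^sup>2 * h x) * indicator {0..} x \<partial>lborel) \<le> (\<integral>\<^sup>+ x. (\<Sum>j. ennreal ((real j + 1)\<^sup>2) * indicator {real j..} x) * ennreal (h x) \<partial>lborel)"
  proof (intro nn_integral_mono)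
    fix x :: real
    show "ennreal (x\<^sup>2 * h x) * indicator {0..} x \<le> (\<Sum>j. ennreal ((real j + 1)\<^sup>2) * indicator {real j..} x) * ennreal (h x)"
    proof (cases "x \<ge> 0")
      case True
      \<comment> \<open>One term of the series, the one at the integer part of \<open>x\<close>,
        already dominates \<open>x\<^sup>2\<close>.\<close>
      define k where "k = nat \<lfloor>x\<rfloor>"
      have k: "real k \<le> x" "x \<le> real k + 1"
        using True by (simp_all add: k_def)
      have "ennreal (x\<^sup>2) \<le> ennreal ((real k + 1)\<^sup>2) * indicator {real k..} x"
        using k True by (auto intro!: ennreal_leI power_mono)
      also have "\<dots> \<le> (\<Sum>j. ennreal ((real j + 1)\<^sup>2) * indicator {real j..} x)"
      proof -
        have "F k \<le> suminf F" for F :: "nat \<Rightarrow> ennreal"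
          using sum_le_suminf[of F "{k}"] by simp
        then show ?thesis .
      qed
      finally show ?thesis
        using True h0 by (simp add: ennreal_mult mult_right_mono)
    qed simp
  qed
  also have "\<dots> = (\<integral>\<^sup>+ x. (\<Sum>j. ennreal ((real j + 1)\<^sup>2) * indicator {real j..} x) \<partial>\<mu>)"
    unfolding \<mu>_def by (subst nn_integral_density) (auto simp: mult.commute)
  also have "\<dots> = (\<Sum>j. ennreal ((real j + 1)\<^sup>2) * emeasure \<mu> {real j..})"
    by (subst nn_integral_suminf) (auto simp: \<mu>_def nn_integral_cmult_indicator)
  also have "\<dots> = (\<Sum>j. ennreal (a j))"
    using M.emeasure_eq_measure by (simp add: a_def \<mu>_def ennreal_mult)
  also have "\<dots> < top"
    unfolding less_top[symmetric] by (intro ennreal_suminf_neq_top \<open>summable a\<close>) (simp add: a_def)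
  finally have half: "(\<integral>\<^sup>+ x. ennreal (x\<^sup>2 * h x) * indicator {0..} x \<partial>lborel) < top" .
  have "(\<integral>\<^sup>+ x. ennreal (x\<^sup>2) \<partial>density lborel h) = (\<integral>\<^sup>+ x. ennreal (x\<^sup>2 * h x) \<partial>lborel)"
    using h0 by (subst nn_integral_density) (auto simp: ennreal_mult mult.commute)
  \<comment> \<open>The two half-lines overlap at 0, hence an inequality; the second one is then
    reflected onto the first.\<close>
  also have "\<dots> \<le> (\<integral>\<^sup>+ x. ennreal (x\<^sup>2 * h x) * indicator {0..} x + ennreal ((- x)\<^sup>2 * h (- x)) * indicator {0..} (- x) \<partial>lborel)"
    by (intro nn_integral_mono) (auto simp: indicator_def sym)
  also have "\<dots> = (\<integral>\<^sup>+ x. ennreal (x\<^sup>2 * h x) * indicator {0..} x \<partial>lborel) + (\<integral>\<^sup>+ x. ennreal ((- x)\<^sup>2 * h (- x)) * indicator {0..} (- x) \<partial>lborel)"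
    by (intro nn_integral_add) measurable
  also have "(\<integral>\<^sup>+ x. ennreal ((- x)\<^sup>2 * h (- x)) * indicator {0..} (- x) \<partial>lborel) = (\<integral>\<^sup>+ x. ennreal (x\<^sup>2 * h x) * indicator {0..} x \<partial>distr lborel borel uminus)"
    by (subst nn_integral_distr) measurable
  also have "distr lborel borel uminus = (lborel :: real measure)"
    by (rule lborel_distr_uminus)
  also have "(\<integral>\<^sup>+ x. ennreal (x\<^sup>2 * h x) * indicator {0..} x \<partial>lborel) + (\<integral>\<^sup>+ x. ennreal (x\<^sup>2 * h x) * indicator {0..} x \<partial>lborel) < top"
    using half by simp
  finally show ?thesis .
qed

section \<open>Ingredients of the small-ball bound: power sums, hyperrectangles, independent
  coordinates\<close>

lemma powr_telescope:
  fixes x s :: real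
  assumes "x \<ge> 1" "s > 0"
  shows "(x + 1) powr (- 1 - s) \<le> (x powr (- s) - (x + 1) powr (- s)) / s"
proof -
  have minus_s: "- s - 1 = - 1 - s" by simp
  \<comment> \<open>The mean value theorem for \<open>x powr (- s)\<close>; since
    \<open>z < x + 1\<close>, the decreasing power at \<open>z\<close> dominates the one at
    \<open>x + 1\<close>.\<close>
  have "\<exists>z>x. z < x + 1 \<and> (x + 1) powr (- s) - x powr (- s) = (x + 1 - x) * (- s * z powr (- s - 1))"
    using assms by (intro MVT2) (auto intro!: derivative_eq_intros simp: powr_diff)
  then obtain z where z: "x < z" "z < x + 1" "x powr (- s) - (x + 1) powr (- s) = s * z powr (- 1 - s)"
    unfolding minus_s by (auto simp: algebra_simps)
  have "(x + 1) powr (- 1 - s) \<le> z powr (- 1 - s)"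
    using z assms by (intro powr_mono2') auto
  then show ?thesis
    using z assms by simp
qed

lemma summable_Suc_powr:
  fixes s :: real
  assumes "s > 0"
  shows "summable (\<lambda>i. real (Suc i) powr (- 1 - s))"
  using summable_real_powr_iff[of "- 1 - s"] assms by (intro summable_Suc_iff[THEN iffD2]) simp

lemma suminf_powr_tail:
  fixes s :: real
  assumes "K \<ge> 1" "s > 0"
  shows "(\<Sum>i. if i < K then 0 else ennreal (real (Suc i) powr (- 1 - s))) \<le> ennreal (real K powr (- s) / s)"
proof (rule suminf_le_const)
  fix n
  \<comment> \<open>Position \<open>i\<close> carries index \<open>Suc i\<close>, so the first term
    that counts is the one at \<open>K + 1\<close>, and telescoping starts from
    \<open>real K powr (- s)\<close>. Taking \<open>max n K\<close> makes the right-hand side 0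
    until the sum becomes nontrivial.\<close>
  have fin: "(\<Sum>i<n. if i < K then 0 else real (Suc i) powr (- 1 - s)) \<le> (real K powr (- s) - real (max n K) powr (- s)) / s"
  proof (induction n)
    case (Suc n)
    show ?case
    proof (cases "n < K")
      case False
      then have "(real n + 1) powr (- 1 - s) \<le> (real n powr (- s) - (real n + 1) powr (- s)) / s"
        using assms by (intro powr_telescope) auto
      then show ?thesis
        using Suc False by (simp add: max_def diff_divide_distrib add.commute)
    qed (use Suc in simp)
  qed simp
  have "(\<Sum>i<n. if i < K then 0 else ennreal (real (Suc i) powr (- 1 - s))) = ennreal (\<Sum>i<n. if i < K then 0 else real (Suc i) powr (- 1 - s))"
    by (subst sum_ennreal[symmetric]) (auto intro!: sum.cong simp del: sum_ennreal)
  also have "\<dots> \<le> ennreal (real K powr (- s) / s)"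
    using order_trans[OF fin divide_right_mono[of _ "real K powr (- s)" s]] assms by (intro ennreal_leI) auto
  finally show "(\<Sum>i<n. if i < K then 0 else ennreal (real (Suc i) powr (- 1 - s))) \<le> ennreal (real K powr (- s) / s)" .
qed simp

text \<open>A crude form of Stirling's formula: the left side divided by \<open>fact K\<close> is a
  single term of the exponential series at \<open>K\<close>.\<close>

lemma power_self_le_exp_fact: "real K ^ K \<le> exp (real K) * fact K"
proof -
  have "(\<Sum>i\<in>{K}. real K ^ i /\<^sub>R fact i) \<le> (\<Sum>i. real K ^ i /\<^sub>R fact i)"
    by (rule sum_le_suminf[OF summable_exp_generic]) auto
  then have "real K ^ K / fact K \<le> exp (real K)"
    by (simp add: exp_def divide_inverse mult.commute)
  then show ?thesis
    by (simp add: field_simps)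
qed

lemma hyperrectangle_abs_le:
  assumes "f\<^sub>0 \<in> hyperrectangle \<beta> L"
  shows "\<bar>f\<^sub>0 i\<bar> \<le> L * real (Suc i) powr (- 1 / 2 - \<beta>)"
proof -
  have "\<bar>f\<^sub>0 i\<bar> * real (Suc i) powr (\<beta> + 1 / 2) \<le> L"
    using assms by (auto simp: hyperrectangle_def)
  then have "\<bar>f\<^sub>0 i\<bar> \<le> L / real (Suc i) powr (\<beta> + 1 / 2)"
    by (simp add: field_simps)
  also have "\<dots> = L * real (Suc i) powr (- (\<beta> + 1 / 2))"
    by (simp only: powr_minus_divide) simp
  also have "- (\<beta> + 1 / 2) = - 1 / 2 - \<beta>"
    by simp
  finally show ?thesis .
qed

lemma hyperrectangle_power2_le:
  assumes "f\<^sub>0 \<in> hyperrectangle \<beta> L"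
  shows "(f\<^sub>0 i)\<^sup>2 \<le> L\<^sup>2 * real (Suc i) powr (- 1 - 2 * \<beta>)"
proof -
  have "(f\<^sub>0 i)\<^sup>2 \<le> (L * real (Suc i) powr (- 1 / 2 - \<beta>))\<^sup>2"
    using power_mono[OF hyperrectangle_abs_le[OF assms, of i], of 2] by simp
  also have "\<dots> = L\<^sup>2 * real (Suc i) powr (- 1 - 2 * \<beta>)"
    by (simp add: power_mult_distrib power2_eq_square flip: powr_add)
  finally show ?thesis .
qed

lemma hyperrectangle_summable:
  assumes "f\<^sub>0 \<in> hyperrectangle \<beta> L" "\<beta> > 0"
  shows "summable (\<lambda>i. (f\<^sub>0 i)\<^sup>2)"
proof (rule summable_comparison_test')
  show "summable (\<lambda>i. L\<^sup>2 * real (Suc i) powr (- 1 - 2 * \<beta>))"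
    using assms by (intro summable_mult summable_Suc_powr) simp
  show "norm ((f\<^sub>0 i)\<^sup>2) \<le> L\<^sup>2 * real (Suc i) powr (- 1 - 2 * \<beta>)" for i
    using hyperrectangle_power2_le[OF assms(1), of i] by simp
qed

text \<open>Given the event on the first \<open>K\<close> coordinates, the weighted tail sum still
  has mean at most \<open>v * W\<close> by independence. By Markov's inequality it exceeds twice
  this value with conditional probability at most 1/2, whence the factor 2. Integrating against the
  indicator \<open>H\<close> of the head event replaces conditioning.\<close>

lemma iid_head_tail:
  assumes h: "prob_density h" and v: "(\<integral>\<^sup>+ x. ennreal (x\<^sup>2) \<partial>density lborel h) \<le> ennreal v" "v > 0"
    and [measurable]: "\<And>i. I i \<in> sets borel"
    and w: "\<And>i. 0 \<le> w i" and wK: "(\<Sum>i. if i < K then 0 else ennreal (w i)) \<le> ennreal W" and W: "W > 0"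
  shows "(\<Prod>i<K. emeasure (density lborel h) (I i))
    \<le> 2 * emeasure (iid_seq h) {\<zeta>\<in>space (iid_seq h). (\<forall>i<K. \<zeta> i \<in> I i) \<and> (\<Sum>i. if i < K then 0 else ennreal (w i * (\<zeta> i)\<^sup>2)) \<le> ennreal (2 * v * W)}"
    (is "?p \<le> 2 * emeasure _ {\<zeta>\<in>_. ?H \<zeta> \<and> ?T \<zeta> \<le> _}")
proof -
  interpret real_sequence_space "density lborel h"
    by (rule real_sequence_space_density[OF h])
  define \<mu> where "\<mu> = density lborel (\<lambda>t. ennreal (h t))"
  have \<mu>1: "emeasure \<mu> UNIV = 1" "space \<mu> = UNIV" and sets_\<mu> [measurable_cong]: "sets \<mu> = sets borel"
    using M.emeasure_space_1 by (simp_all add: \<mu>_def)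
  have S: "iid_seq h = S" "S = Pi\<^sub>M UNIV (\<lambda>_. \<mu>)"
    by (simp_all add: iid_seq_def \<mu>_def)
  define H where "H \<zeta> = (\<Prod>i<K. indicator (I i) (\<zeta> i) :: ennreal)" for \<zeta>
  have H_eq: "H \<zeta> = (if ?H \<zeta> then 1 else 0)" for \<zeta>
    by (auto simp: H_def indicator_def)
  have Hm [measurable]: "H \<in> borel_measurable S"
    unfolding H_def by measurable
  have Tm [measurable]: "?T \<in> borel_measurable S"
    by measurable
  define good where "good = {\<zeta>\<in>space S. ?H \<zeta> \<and> ?T \<zeta> \<le> ennreal (2 * v * W)}"
  have [measurable]: "good \<in> sets S"
    unfolding good_def by measurable
  have IH: "(\<integral>\<^sup>+ \<zeta>. H \<zeta> \<partial>S) = ?p"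
    unfolding H_def by (subst nn_integral_S_prod) auto
  have IHz: "(\<integral>\<^sup>+ \<zeta>. H \<zeta> * ennreal ((\<zeta> i)\<^sup>2) \<partial>S) \<le> ?p * ennreal v" if "i \<ge> K" for i
  proof -
    \<comment> \<open>One product of one-coordinate functions combines the head indicators with the
      square at position \<open>i\<close>, the coordinates in between contributing 1.\<close>
    define g where "g j = (if j < K then indicator (I j) else if j = i then (\<lambda>x. ennreal (x\<^sup>2)) else (\<lambda>_. 1 :: ennreal))" for j
    have gm: "g j \<in> borel_measurable borel" for j
      unfolding g_def by auto
    have split: "(\<Prod>j<Suc i. F j) = (\<Prod>j<K. F j) * (\<Prod>j\<in>{K..<i}. F j) * F i" for F :: "nat \<Rightarrow> ennreal"
    proof -
      have "(\<Prod>j<i. F j) = (\<Prod>j<K. F j) * (\<Prod>j\<in>{K..<i}. F j)"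
        using prod.atLeastLessThan_concat[of 0 K i F] that by (simp add: atLeast0LessThan)
      then show ?thesis by simp
    qed
    have "(\<integral>\<^sup>+ \<zeta>. H \<zeta> * ennreal ((\<zeta> i)\<^sup>2) \<partial>S) = (\<integral>\<^sup>+ \<zeta>. (\<Prod>j<Suc i. g j (\<zeta> j)) \<partial>S)"
      unfolding split using that by (intro nn_integral_cong) (auto simp: H_def g_def)
    also have "\<dots> = (\<Prod>j<Suc i. \<integral>\<^sup>+ x. g j x \<partial>\<mu>)"
      unfolding \<mu>_def by (intro nn_integral_S_prod gm)
    also have "\<dots> = ?p * (\<integral>\<^sup>+ x. ennreal (x\<^sup>2) \<partial>\<mu>)"
      unfolding split using that by (auto simp: g_def \<mu>1 \<mu>_def[symmetric] intro!: arg_cong2[where f = "(*)"] prod.neutral)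
    also have "\<dots> \<le> ?p * ennreal v"
      using v by (intro mult_left_mono) (auto simp: \<mu>_def)
    finally show ?thesis .
  qed
  have "(\<integral>\<^sup>+ \<zeta>. H \<zeta> * ?T \<zeta> \<partial>S) = (\<integral>\<^sup>+ \<zeta>. (\<Sum>i. (if i < K then 0 else ennreal (w i)) * (H \<zeta> * ennreal ((\<zeta> i)\<^sup>2))) \<partial>S)"
  proof (intro nn_integral_cong)
    fix \<zeta>
    have "(\<Sum>i. (if i < K then 0 else ennreal (w i)) * (H \<zeta> * ennreal ((\<zeta> i)\<^sup>2)))
        = (\<Sum>i. H \<zeta> * (if i < K then 0 else ennreal (w i * (\<zeta> i)\<^sup>2)))"
      by (intro suminf_cong) (auto simp: ennreal_mult w ac_simps)
    then show "H \<zeta> * ?T \<zeta> = (\<Sum>i. (if i < K then 0 else ennreal (w i)) * (H \<zeta> * ennreal ((\<zeta> i)\<^sup>2)))"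
      by (simp only: ennreal_suminf_cmult)
  qed
  also have "\<dots> = (\<Sum>i. (if i < K then 0 else ennreal (w i)) * (\<integral>\<^sup>+ \<zeta>. H \<zeta> * ennreal ((\<zeta> i)\<^sup>2) \<partial>S))"
    by (subst nn_integral_suminf) (simp_all add: nn_integral_cmult)
  also have "\<dots> \<le> (\<Sum>i. (if i < K then 0 else ennreal (w i)) * (?p * ennreal v))"
    using IHz by (intro suminf_le) (auto intro!: mult_left_mono)
  also have "\<dots> = (\<Sum>i. if i < K then 0 else ennreal (w i)) * (?p * ennreal v)"
    by (intro ennreal_suminf_multc)
  also have "\<dots> \<le> ennreal W * (?p * ennreal v)"
    by (intro mult_right_mono wK) auto
  finally have HT: "(\<integral>\<^sup>+ \<zeta>. H \<zeta> * ?T \<zeta> \<partial>S) \<le> ennreal W * (?p * ennreal v)" .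
  have "?p = (\<integral>\<^sup>+ \<zeta>. H \<zeta> \<partial>S)"
    by (rule IH[symmetric])
  also have "\<dots> \<le> (\<integral>\<^sup>+ \<zeta>. indicator good \<zeta> + ennreal (1 / (2 * v * W)) * (H \<zeta> * ?T \<zeta>) \<partial>S)"
  proof (intro nn_integral_mono)
    fix \<zeta> assume "\<zeta> \<in> space S"
    \<comment> \<open>If the head event holds outside \<open>good\<close>, the tail sum exceeds
      \<open>2 * v * W\<close>, so the second summand alone is at least 1.\<close>
    show "H \<zeta> \<le> indicator good \<zeta> + ennreal (1 / (2 * v * W)) * (H \<zeta> * ?T \<zeta>)"
    proof (cases "?H \<zeta> \<and> \<zeta> \<notin> good")
      case True
      then have "ennreal (2 * v * W) \<le> ?T \<zeta>"
        using \<open>\<zeta> \<in> space S\<close> by (auto simp: good_def)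
      then have "ennreal (1 / (2 * v * W)) * ennreal (2 * v * W) \<le> ennreal (1 / (2 * v * W)) * ?T \<zeta>"
        by (intro mult_left_mono) auto
      then show ?thesis
        using True v W by (simp add: H_eq flip: ennreal_mult)
    next
      case False
      then have "H \<zeta> \<le> indicator good \<zeta>"
        by (auto simp: H_eq good_def)
      then show ?thesis
        by (rule order_trans) simp
    qed
  qed
  also have "\<dots> = emeasure S good + ennreal (1 / (2 * v * W)) * (\<integral>\<^sup>+ \<zeta>. H \<zeta> * ?T \<zeta> \<partial>S)"
    by (subst nn_integral_add) (simp_all add: nn_integral_cmult)
  also have "\<dots> \<le> emeasure S good + ennreal (1 / (2 * v * W)) * (ennreal W * (?p * ennreal v))"
    by (intro add_left_mono mult_left_mono HT) auto
  finally have le: "?p \<le> emeasure S good + ennreal (1 / (2 * v * W)) * (ennreal W * (?p * ennreal v))" .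
  \<comment> \<open>Finiteness permits moving to the reals and subtracting the half that Markov's
    inequality leaves on the right.\<close>
  have "?p \<le> 1"
    using M.emeasure_le_1 by (intro prod_le_1) auto
  then obtain x where x: "?p = ennreal x" "x \<ge> 0"
    by (cases ?p) (auto simp: top_unique)
  obtain y where y: "emeasure S good = ennreal y" "y \<ge> 0"
    using P.emeasure_eq_measure[of good] by (auto intro: that[OF _ measure_nonneg])
  have "ennreal (1 / (2 * v * W)) * (ennreal W * (?p * ennreal v)) = ennreal (x / 2)"
    using x v W by (simp flip: ennreal_mult)
  then have "x \<le> y + x / 2"
    using le x y by (simp flip: ennreal_plus)
  then have "x \<le> 2 * y" by simp
  then have "ennreal x \<le> 2 * ennreal y"
    using ennreal_leI[of x "2 * y"] ennreal_mult[of 2 y] y by simp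
  then have "?p \<le> 2 * emeasure S good"
    by (simp add: x y)
  then show ?thesis
    unfolding good_def S(1) .
qed

text \<open>The interval lies within distance \<open>V\<close> of the origin, where symmetry and the
  lower tail bound keep the density above its guaranteed value at \<open>V\<close>;
  \<open>2 * w\<close> is the length.\<close>

lemma exp_tails_interval_ge:
  assumes h: "prob_density h" "\<And>t. h (- t) = h t" and c: "c\<^sub>0 > 0" "c\<^sub>1 > 0" "p > 0"
    and lower: "\<And>t. t \<ge> 0 \<Longrightarrow> h t \<ge> c\<^sub>0 * exp (- c\<^sub>1 * t powr p)"
    and w: "0 \<le> w" "\<bar>u\<bar> + w \<le> V"
  shows "ennreal (2 * w * (c\<^sub>0 * exp (- c\<^sub>1 * V powr p))) \<le> emeasure (density lborel h) {u - w..u + w}"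
proof -
  have hm [measurable]: "h \<in> borel_measurable borel"
    using h by (simp add: prob_density_def)
  have ge: "c\<^sub>0 * exp (- c\<^sub>1 * V powr p) \<le> h t" if "t \<in> {u - w..u + w}" for t
  proof -
    have "\<bar>t\<bar> powr p \<le> V powr p"
      using that w c by (intro powr_mono2) auto
    then have "c\<^sub>0 * exp (- c\<^sub>1 * V powr p) \<le> c\<^sub>0 * exp (- c\<^sub>1 * \<bar>t\<bar> powr p)"
      using c by simp
    also have "\<dots> \<le> h \<bar>t\<bar>"
      by (intro lower) simp
    also have "h \<bar>t\<bar> = h t"
      using h(2) by (simp add: abs_if)
    finally show ?thesis .
  qed
  have "ennreal (2 * w * (c\<^sub>0 * exp (- c\<^sub>1 * V powr p))) = (\<integral>\<^sup>+ t. ennreal (c\<^sub>0 * exp (- c\<^sub>1 * V powr p)) * indicator {u - w..u + w} t \<partial>lborel)"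
    using w c by (subst nn_integral_cmult_indicator) (simp_all add: mult.commute flip: ennreal_mult)
  also have "\<dots> \<le> (\<integral>\<^sup>+ t. ennreal (h t) * indicator {u - w..u + w} t \<partial>lborel)"
    using ge by (intro nn_integral_mono) (auto simp: indicator_def intro!: ennreal_leI)
  also have "\<dots> = emeasure (density lborel h) {u - w..u + w}"
    by (subst emeasure_density) simp_all
  finally show ?thesis .
qed

text \<open>The product is a power of \<open>fact K / real K ^ K\<close>. Windows that shrink like a
  power of \<open>Suc i / K\<close> therefore cost only an exponential in \<open>K\<close>, without
  a logarithmic factor.\<close>

lemma prod_scale_ge:
  assumes "K \<ge> 1" "s > 0"
  shows "exp (- s * real K) \<le> (\<Prod>i<K. (real (Suc i) / real K) powr s)"
proof -
  have "real K ^ K \<le> exp (real K) * fact K"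
    by (rule power_self_le_exp_fact)
  then have "exp (- real K) \<le> fact K / real K ^ K"
    using assms by (simp add: exp_minus field_simps)
  also have "\<dots> = (\<Prod>i<K. real (Suc i) / real K)"
    by (simp add: prod_dividef fact_prod_Suc atLeast0LessThan)
  finally have "exp (- real K) powr s \<le> (\<Prod>i<K. real (Suc i) / real K) powr s"
    using assms by (intro powr_mono2) auto
  also have "\<dots> = (\<Prod>i<K. (real (Suc i) / real K) powr s)"
    by (subst prod_powr_distrib) auto
  finally show ?thesis
    by (simp add: powr_def mult.commute)
qed

section \<open>The series prior: support and mass of balls\<close>

lemma prior_scale_power2: "(prior_scale \<alpha> i)\<^sup>2 = real (Suc i) powr (- 1 - 2 * \<alpha>)"
  by (simp add: prior_scale_def power2_eq_square flip: powr_add)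

lemma series_prior_map_measurable [measurable]:
  "(\<lambda>\<zeta> i. prior_scale \<alpha> i * \<zeta> i) \<in> iid_seq h \<rightarrow>\<^sub>M seq_space"
  by (intro measurable_PiM_single') (auto simp: space_PiM)

lemma prob_space_iid_seq:
  assumes "prob_density h"
  shows "prob_space (iid_seq h)"
proof -
  interpret real_sequence_space "density lborel h"
    by (rule real_sequence_space_density[OF assms])
  show ?thesis
    unfolding iid_seq_def by (rule P.prob_space_axioms)
qed

lemma prob_space_series_prior:
  assumes "prob_density h"
  shows "prob_space (series_prior \<alpha> h)"
  unfolding series_prior_def
  by (intro prob_space.prob_space_distr prob_space_iid_seq assms series_prior_map_measurable)

text \<open>The expected squared norm is the sum of the squared scales times the second moment,
  hence finite.\<close>

lemma series_prior_AE_summable: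
  assumes h: "prob_density h" and m2: "(\<integral>\<^sup>+ x. ennreal (x\<^sup>2) \<partial>density lborel h) < top" and "\<alpha> > 0"
  shows "AE f in series_prior \<alpha> h. summable (\<lambda>i. (f i)\<^sup>2)"
proof -
  interpret real_sequence_space "density lborel h"
    by (rule real_sequence_space_density[OF h])
  have [measurable_cong]: "sets (iid_seq h) = sets seq_space"
    by (rule sets_iid_seq)
  have "(\<integral>\<^sup>+ \<zeta>. (\<Sum>i. ennreal ((prior_scale \<alpha> i * \<zeta> i)\<^sup>2)) \<partial>iid_seq h)
      = (\<Sum>i. \<integral>\<^sup>+ \<zeta>. ennreal ((prior_scale \<alpha> i)\<^sup>2) * ennreal ((\<zeta> i)\<^sup>2) \<partial>iid_seq h)"
    by (subst nn_integral_suminf) (simp_all add: power_mult_distrib ennreal_mult)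
  also have "\<dots> = (\<Sum>i. ennreal ((prior_scale \<alpha> i)\<^sup>2) * (\<integral>\<^sup>+ x. ennreal (x\<^sup>2) \<partial>density lborel h))"
  proof (intro suminf_cong)
    fix i
    have "(\<integral>\<^sup>+ \<zeta>. ennreal ((\<zeta> i)\<^sup>2) \<partial>iid_seq h) = (\<integral>\<^sup>+ x. ennreal (x\<^sup>2) \<partial>density lborel h)"
      unfolding iid_seq_def by (rule nn_integral_S_component) simp
    moreover have "(\<integral>\<^sup>+ \<zeta>. ennreal ((prior_scale \<alpha> i)\<^sup>2) * ennreal ((\<zeta> i)\<^sup>2) \<partial>iid_seq h)
        = ennreal ((prior_scale \<alpha> i)\<^sup>2) * (\<integral>\<^sup>+ \<zeta>. ennreal ((\<zeta> i)\<^sup>2) \<partial>iid_seq h)"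
      by (intro nn_integral_cmult) measurable
    ultimately show "(\<integral>\<^sup>+ \<zeta>. ennreal ((prior_scale \<alpha> i)\<^sup>2) * ennreal ((\<zeta> i)\<^sup>2) \<partial>iid_seq h)
        = ennreal ((prior_scale \<alpha> i)\<^sup>2) * (\<integral>\<^sup>+ x. ennreal (x\<^sup>2) \<partial>density lborel h)"
      by simp
  qed
  also have "\<dots> = (\<Sum>i. ennreal ((prior_scale \<alpha> i)\<^sup>2)) * (\<integral>\<^sup>+ x. ennreal (x\<^sup>2) \<partial>density lborel h)"
    by (rule ennreal_suminf_multc)
  also have "\<dots> < top"
  proof -
    have "summable (\<lambda>i. (prior_scale \<alpha> i)\<^sup>2)"
      unfolding prior_scale_power2 using \<open>\<alpha> > 0\<close> by (intro summable_Suc_powr) simp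
    then have "(\<Sum>i. ennreal ((prior_scale \<alpha> i)\<^sup>2)) < top"
      unfolding less_top[symmetric] by (intro ennreal_suminf_neq_top) auto
    then show ?thesis
      using m2 by (intro ennreal_mult_less_top[THEN iffD2]) blast
  qed
  finally have "AE \<zeta> in iid_seq h. (\<Sum>i. ennreal ((prior_scale \<alpha> i * \<zeta> i)\<^sup>2)) \<noteq> \<infinity>"
    by (intro nn_integral_PInf_AE) (auto simp: less_top)
  then have "AE f in series_prior \<alpha> h. (\<Sum>i. ennreal ((f i)\<^sup>2)) \<noteq> \<infinity>"
    unfolding series_prior_def by (subst AE_distr_iff) measurable
  then show ?thesis
  proof eventually_elim
    case (elim f)
    then show ?case
      unfolding infinity_ennreal_def by (intro summable_suminf_not_top[of "\<lambda>i. (f i)\<^sup>2"] zero_le_power2)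
  qed
qed

text \<open>The cutoff \<open>K\<close> trades radius against mass. With
  \<open>max (\<alpha> - \<beta>) 0\<close> and \<open>min \<alpha> \<beta>\<close> the two
  smoothness regimes are treated at once: the former measures how far the rescaled truth can leave
  the bulk of \<open>h\<close>, the latter is the approximation order.\<close>

lemma series_prior_mass:
  assumes "p > 0" "\<alpha> > 0" "\<beta> > 0" "L > 0" and f0: "f\<^sub>0 \<in> hyperrectangle \<beta> L"
    and h: "prob_density h" and tails: "exp_tails p h"
  shows "\<exists>A>0. \<exists>C>0. \<forall>K\<ge>1. exp (- C * real K powr (1 + p * max (\<alpha> - \<beta>) 0))
      \<le> measure (series_prior \<alpha> h) (l2_cball f\<^sub>0 (A * real K powr (- min \<alpha> \<beta>)))"
proof -
  define m \<gamma> where "m = max (\<alpha> - \<beta>) 0" and "\<gamma> = min \<alpha> \<beta>"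
  have m: "m \<ge> 0" "\<alpha> - \<beta> \<le> m" and \<gamma>: "\<gamma> \<le> \<alpha>" "\<gamma> \<le> \<beta>"
    by (simp_all add: m_def \<gamma>_def)
  obtain c\<^sub>0 c\<^sub>1 where c: "c\<^sub>0 > 0" "c\<^sub>1 > 0" and lower: "\<And>t. t \<ge> 0 \<Longrightarrow> h t \<ge> c\<^sub>0 * exp (- c\<^sub>1 * t powr p)"
    using tails unfolding exp_tails_def by blast
  have sym: "\<And>t. h (- t) = h t"
    using tails by (simp add: exp_tails_def)
  define v where "v = enn2real (\<integral>\<^sup>+ x. ennreal (x\<^sup>2) \<partial>density lborel h) + 1"
  have v: "(\<integral>\<^sup>+ x. ennreal (x\<^sup>2) \<partial>density lborel h) \<le> ennreal v" "v > 0"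
  proof -
    have "(\<integral>\<^sup>+ x. ennreal (x\<^sup>2) \<partial>density lborel h) = ennreal (enn2real (\<integral>\<^sup>+ x. ennreal (x\<^sup>2) \<partial>density lborel h))"
      using exp_tails_second_moment[OF h tails] by simp
    also have "\<dots> \<le> ennreal v"
      unfolding v_def by (intro ennreal_leI) simp
    finally show "(\<integral>\<^sup>+ x. ennreal (x\<^sup>2) \<partial>density lborel h) \<le> ennreal v" .
    show "v > 0"
      unfolding v_def using enn2real_nonneg[of "\<integral>\<^sup>+ x. ennreal (x\<^sup>2) \<partial>density lborel h"] by linarith
  qed
  \<comment> \<open>The summands are the contributions to the squared distance: 1 from the head
    windows, \<open>2 * v / \<alpha>\<close> from the tail of the prior draw and
    \<open>L\<^sup>2 / \<beta>\<close> from the tail of \<open>f\<^sub>0\<close>.\<close>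
  define A where "A = sqrt (1 + 2 * v / \<alpha> + L\<^sup>2 / \<beta>)"
  have A2: "A\<^sup>2 = 1 + 2 * v / \<alpha> + L\<^sup>2 / \<beta>" and "A > 0"
    using assms v by (simp_all add: A_def add_pos_nonneg)
  \<comment> \<open>The terms come from the factor \<open>2 * c\<^sub>0\<close> per coordinate, the
    exponential lower bound at \<open>V\<close> and the product of the windows. The final 1 absorbs
    the factor 2 of \<open>iid_head_tail\<close>, since \<open>2 \<le> exp k\<close> for
    \<open>k \<ge> 1\<close>.\<close>
  define C where "C = \<bar>ln (2 * c\<^sub>0)\<bar> + c\<^sub>1 * (L + 1) powr p + (1 / 2 + \<alpha>) + 1"
  have "c\<^sub>1 * (L + 1) powr p \<ge> 0" using c by simp
  then have "C > 0" using assms by (simp add: C_def)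
  have "exp (- C * real K powr (1 + p * m)) \<le> measure (series_prior \<alpha> h) (l2_cball f\<^sub>0 (A * real K powr (- \<gamma>)))"
    if "K \<ge> 1" for K :: nat
  proof -
    define u where "u i = f\<^sub>0 i / prior_scale \<alpha> i" for i
    \<comment> \<open>After scaling, every head window has the same half-width
      \<open>real K powr (- 1 / 2 - \<alpha>)\<close>, so the \<open>K\<close> squared errors add up
      to at most \<open>real K powr (- 2 * \<alpha>)\<close>.\<close>
    define w where "w i = (real (Suc i) / real K) powr (1 / 2 + \<alpha>)" for i
    \<comment> \<open>The rescaled truth \<open>u i\<close> is at most
      \<open>L * real K powr m\<close> in absolute value for \<open>i < K\<close>, and the windows
      have half-width at most 1.\<close>
    define V where "V = L * real K powr m + 1"
    define E where "E = c\<^sub>0 * exp (- c\<^sub>1 * V powr p)"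
    define W where "W = real K powr (- 2 * \<alpha>) / (2 * \<alpha>)"
    have K: "real K \<ge> 1" using that by simp
    have s0: "prior_scale \<alpha> i > 0" for i
      by (simp add: prior_scale_def)
    have W: "W > 0" using that assms by (simp add: W_def)
    define good where "good = {\<zeta>\<in>space (iid_seq h). (\<forall>i<K. \<zeta> i \<in> {u i - w i..u i + w i})
        \<and> (\<Sum>i. if i < K then 0 else ennreal ((prior_scale \<alpha> i)\<^sup>2 * (\<zeta> i)\<^sup>2)) \<le> ennreal (2 * v * W)}"
    have "(\<Sum>i. if i < K then 0 else ennreal ((prior_scale \<alpha> i)\<^sup>2)) \<le> ennreal W"
      using suminf_powr_tail[OF that, of "2 * \<alpha>"] assms by (simp add: prior_scale_power2 W_def cong: if_cong)
    then have prod_le: "(\<Prod>i<K. emeasure (density lborel h) {u i - w i..u i + w i}) \<le> 2 * emeasure (iid_seq h) good"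
      unfolding good_def by (intro iid_head_tail h v W) auto
    have ball: "(\<lambda>i. prior_scale \<alpha> i * \<zeta> i) \<in> l2_cball f\<^sub>0 (A * real K powr (- \<gamma>))" if \<zeta>: "\<zeta> \<in> good" for \<zeta>
    proof -
      define f where "f i = prior_scale \<alpha> i * \<zeta> i" for i
      have head: "(f i - f\<^sub>0 i)\<^sup>2 \<le> real K powr (- 1 - 2 * \<alpha>)" if "i < K" for i
      proof -
        have "\<bar>\<zeta> i - u i\<bar> \<le> w i"
          using \<zeta> that by (auto simp: good_def abs_le_iff)
        then have "prior_scale \<alpha> i * \<bar>\<zeta> i - u i\<bar> \<le> prior_scale \<alpha> i * w i"
          using s0[of i] by (intro mult_left_mono) auto
        also have "prior_scale \<alpha> i * \<bar>\<zeta> i - u i\<bar> = \<bar>f i - f\<^sub>0 i\<bar>"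
        proof -
          have "f i - f\<^sub>0 i = prior_scale \<alpha> i * (\<zeta> i - u i)"
            using s0[of i] by (simp add: f_def u_def field_simps)
          then show ?thesis
            using s0[of i] by (simp add: abs_mult)
        qed
        also have "prior_scale \<alpha> i * w i = real K powr (- 1 / 2 - \<alpha>)"
        proof -
          have "real (Suc i) powr (- 1 / 2 - \<alpha>) * real (Suc i) powr (1 / 2 + \<alpha>) = 1"
            by (simp flip: powr_add)
          moreover have "real K powr (- 1 / 2 - \<alpha>) = 1 / real K powr (1 / 2 + \<alpha>)"
            using powr_minus_divide[of "real K" "1 / 2 + \<alpha>"] by simp
          ultimately show ?thesis
            using K by (simp add: prior_scale_def w_def powr_divide)
        qed
        finally have "\<bar>f i - f\<^sub>0 i\<bar>\<^sup>2 \<le> (real K powr (- 1 / 2 - \<alpha>))\<^sup>2"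
          by (intro power_mono) auto
        then show ?thesis
          by (simp add: power2_eq_square flip: powr_add)
      qed
      have tail: "(f i - f\<^sub>0 i)\<^sup>2 \<le> 2 * ((prior_scale \<alpha> i)\<^sup>2 * (\<zeta> i)\<^sup>2) + 2 * L\<^sup>2 * real (Suc i) powr (- 1 - 2 * \<beta>)" for i
      proof -
        have "0 \<le> (f i + f\<^sub>0 i)\<^sup>2" by simp
        then have "(f i - f\<^sub>0 i)\<^sup>2 \<le> 2 * (f i)\<^sup>2 + 2 * (f\<^sub>0 i)\<^sup>2"
          unfolding power2_sum power2_diff by linarith
        then show ?thesis
          using hyperrectangle_power2_le[OF f0, of i] by (simp add: f_def power_mult_distrib)
      qed
      have "(\<Sum>i. ennreal ((f i - f\<^sub>0 i)\<^sup>2))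
         \<le> (\<Sum>i. (if i < K then ennreal (real K powr (- 1 - 2 * \<alpha>)) else 0)
            + (2 * (if i < K then 0 else ennreal ((prior_scale \<alpha> i)\<^sup>2 * (\<zeta> i)\<^sup>2))
             + ennreal (2 * L\<^sup>2) * (if i < K then 0 else ennreal (real (Suc i) powr (- 1 - 2 * \<beta>)))))"
      proof (intro suminf_le allI)
        fix i
        show "ennreal ((f i - f\<^sub>0 i)\<^sup>2) \<le> (if i < K then ennreal (real K powr (- 1 - 2 * \<alpha>)) else 0)
            + (2 * (if i < K then 0 else ennreal ((prior_scale \<alpha> i)\<^sup>2 * (\<zeta> i)\<^sup>2))
             + ennreal (2 * L\<^sup>2) * (if i < K then 0 else ennreal (real (Suc i) powr (- 1 - 2 * \<beta>))))"
        proof (cases "i < K")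
          case True
          then show ?thesis using head[OF True] by (simp add: ennreal_leI)
        next
          case False
          have "ennreal ((f i - f\<^sub>0 i)\<^sup>2) \<le> ennreal (2 * ((prior_scale \<alpha> i)\<^sup>2 * (\<zeta> i)\<^sup>2) + 2 * L\<^sup>2 * real (Suc i) powr (- 1 - 2 * \<beta>))"
            by (intro ennreal_leI tail)
          also have "\<dots> = ennreal 2 * ennreal ((prior_scale \<alpha> i)\<^sup>2 * (\<zeta> i)\<^sup>2) + ennreal (2 * L\<^sup>2) * ennreal (real (Suc i) powr (- 1 - 2 * \<beta>))"
            by (subst ennreal_mult[symmetric], simp, simp)+ (simp flip: ennreal_plus)
          finally show ?thesis using False by simp
        qed
      qed simp_all
      also have "\<dots> = (\<Sum>i. if i < K then ennreal (real K powr (- 1 - 2 * \<alpha>)) else 0)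
            + (2 * (\<Sum>i. if i < K then 0 else ennreal ((prior_scale \<alpha> i)\<^sup>2 * (\<zeta> i)\<^sup>2))
             + ennreal (2 * L\<^sup>2) * (\<Sum>i. if i < K then 0 else ennreal (real (Suc i) powr (- 1 - 2 * \<beta>))))"
        by (simp only: suminf_add[OF summableI summableI, symmetric] ennreal_suminf_cmult)
      also have "\<dots> \<le> ennreal (real K powr (- 2 * \<alpha>)) + (2 * ennreal (2 * v * W) + ennreal (2 * L\<^sup>2) * ennreal (real K powr (- 2 * \<beta>) / (2 * \<beta>)))"
      proof (intro add_mono mult_left_mono)
        have "(\<Sum>i. if i < K then ennreal (real K powr (- 1 - 2 * \<alpha>)) else 0) = (\<Sum>i<K. ennreal (real K powr (- 1 - 2 * \<alpha>)))"
          using sums_If_finite_set[of "{..<K}" "\<lambda>_. ennreal (real K powr (- 1 - 2 * \<alpha>))"] by (simp add: sums_iff)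
        also have "\<dots> = ennreal (real K * real K powr (- 1 - 2 * \<alpha>))"
          by (simp add: ennreal_of_nat_eq_real_of_nat flip: ennreal_mult)
        also have "real K * real K powr (- 1 - 2 * \<alpha>) = real K powr (1 + (- 1 - 2 * \<alpha>))"
          using K by (subst powr_add) simp
        also have "1 + (- 1 - 2 * \<alpha>) = - 2 * \<alpha>" by simp
        finally show "(\<Sum>i. if i < K then ennreal (real K powr (- 1 - 2 * \<alpha>)) else 0) \<le> ennreal (real K powr (- 2 * \<alpha>))"
          by simp
        show "(\<Sum>i. if i < K then 0 else ennreal ((prior_scale \<alpha> i)\<^sup>2 * (\<zeta> i)\<^sup>2)) \<le> ennreal (2 * v * W)"
          using \<zeta> by (simp add: good_def)
        show "(\<Sum>i. if i < K then 0 else ennreal (real (Suc i) powr (- 1 - 2 * \<beta>))) \<le> ennreal (real K powr (- 2 * \<beta>) / (2 * \<beta>))"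
          using suminf_powr_tail[OF \<open>K \<ge> 1\<close>, of "2 * \<beta>"] assms by simp
      qed simp_all
      also have "\<dots> = ennreal (real K powr (- 2 * \<alpha>) + (2 * (2 * v * W) + (2 * L\<^sup>2) * (real K powr (- 2 * \<beta>) / (2 * \<beta>))))"
      proof -
        have "2 * ennreal (2 * v * W) = ennreal (2 * (2 * v * W))"
          using v W by (subst ennreal_mult) auto
        then show ?thesis
          using v W assms by (simp flip: ennreal_mult ennreal_plus)
      qed
      also have "\<dots> \<le> ennreal ((A * real K powr (- \<gamma>))\<^sup>2)"
      proof (intro ennreal_leI)
        define g where "g = real K powr (- 2 * \<gamma>)"
        have a: "real K powr (- 2 * \<alpha>) \<le> g" and b: "real K powr (- 2 * \<beta>) \<le> g"
          unfolding g_def using K \<gamma> by (auto intro!: powr_mono)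
        have "real K powr (- 2 * \<alpha>) + (2 * (2 * v * W) + (2 * L\<^sup>2) * (real K powr (- 2 * \<beta>) / (2 * \<beta>)))
           = real K powr (- 2 * \<alpha>) + (2 * v / \<alpha>) * real K powr (- 2 * \<alpha>) + (L\<^sup>2 / \<beta>) * real K powr (- 2 * \<beta>)"
          using assms by (simp add: W_def field_simps)
        also have "\<dots> \<le> g + (2 * v / \<alpha>) * g + (L\<^sup>2 / \<beta>) * g"
          using a b v assms by (intro add_mono mult_left_mono) auto
        also have "\<dots> = A\<^sup>2 * g"
          by (simp add: A2 algebra_simps)
        also have "\<dots> = (A * real K powr (- \<gamma>))\<^sup>2"
          unfolding g_def by (simp add: power_mult_distrib power2_eq_square flip: powr_add)
        finally show "real K powr (- 2 * \<alpha>) + (2 * (2 * v * W) + (2 * L\<^sup>2) * (real K powr (- 2 * \<beta>) / (2 * \<beta>))) \<le> (A * real K powr (- \<gamma>))\<^sup>2" .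
      qed
      finally show ?thesis
        using \<open>A > 0\<close> by (subst l2_cball_iff) (simp_all add: f_def)
    qed
    have "emeasure (iid_seq h) good \<le> emeasure (series_prior \<alpha> h) (l2_cball f\<^sub>0 (A * real K powr (- \<gamma>)))"
    proof -
      have "l2_cball f\<^sub>0 (A * real K powr (- \<gamma>)) \<in> sets seq_space"
        using \<open>A > 0\<close> by (intro measurable_l2_cball) simp
      then have "emeasure (series_prior \<alpha> h) (l2_cball f\<^sub>0 (A * real K powr (- \<gamma>)))
          = emeasure (iid_seq h) ((\<lambda>\<zeta> i. prior_scale \<alpha> i * \<zeta> i) -` l2_cball f\<^sub>0 (A * real K powr (- \<gamma>)) \<inter> space (iid_seq h))"
        unfolding series_prior_def by (intro emeasure_distr) measurable
      moreover have "(\<lambda>\<zeta> i. prior_scale \<alpha> i * \<zeta> i) -` l2_cball f\<^sub>0 (A * real K powr (- \<gamma>)) \<inter> space (iid_seq h) \<in> sets (iid_seq h)"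
        by (rule measurable_sets[OF series_prior_map_measurable]) fact
      ultimately show ?thesis
        using ball by (auto intro!: emeasure_mono simp: good_def)
    qed
    then have "(\<Prod>i<K. emeasure (density lborel h) {u i - w i..u i + w i}) \<le> 2 * emeasure (series_prior \<alpha> h) (l2_cball f\<^sub>0 (A * real K powr (- \<gamma>)))"
      using prod_le by (meson mult_left_mono order_trans zero_le)
    moreover have "ennreal (\<Prod>i<K. 2 * w i * E) \<le> (\<Prod>i<K. emeasure (density lborel h) {u i - w i..u i + w i})"
    proof -
      have "ennreal (2 * w i * E) \<le> emeasure (density lborel h) {u i - w i..u i + w i}" if "i < K" for i
        unfolding E_def
      proof (intro exp_tails_interval_ge h sym c assms lower)
        show "0 \<le> w i" by (simp add: w_def)
        have "w i \<le> 1"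
          unfolding w_def using that assms by (intro powr_le1) auto
        moreover have "\<bar>u i\<bar> \<le> L * real K powr m"
        proof -
          have "\<bar>u i\<bar> \<le> L * real (Suc i) powr (- 1 / 2 - \<beta>) / prior_scale \<alpha> i"
            unfolding u_def abs_divide using hyperrectangle_abs_le[OF f0, of i] s0[of i]
            by (intro frac_le) auto
          also have "\<dots> = L * real (Suc i) powr (\<alpha> - \<beta>)"
            using powr_diff[of "real (Suc i)" "- 1 / 2 - \<beta>" "- 1 / 2 - \<alpha>"] by (simp add: prior_scale_def)
          also have "\<dots> \<le> L * real (Suc i) powr m"
            using m assms by (intro mult_left_mono powr_mono) auto
          also have "\<dots> \<le> L * real K powr m"
            using m assms that by (intro mult_left_mono powr_mono2) auto
          finally show ?thesis .
        qed
        ultimately show "\<bar>u i\<bar> + w i \<le> V" by (simp add: V_def)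
      qed
      then have "(\<Prod>i<K. ennreal (2 * w i * E)) \<le> (\<Prod>i<K. emeasure (density lborel h) {u i - w i..u i + w i})"
        by (intro prod_mono_ennreal) simp
      moreover have "(\<Prod>i<K. ennreal (2 * w i * E)) = ennreal (\<Prod>i<K. 2 * w i * E)"
        using c by (intro prod_ennreal) (simp add: w_def E_def)
      ultimately show ?thesis by simp
    qed
    ultimately have "ennreal (\<Prod>i<K. 2 * w i * E) \<le> 2 * emeasure (series_prior \<alpha> h) (l2_cball f\<^sub>0 (A * real K powr (- \<gamma>)))"
      by (rule order_trans[rotated])
    then have "ennreal (\<Prod>i<K. 2 * w i * E) \<le> ennreal (2 * measure (series_prior \<alpha> h) (l2_cball f\<^sub>0 (A * real K powr (- \<gamma>))))"
      using prob_space_series_prior[OF h, of \<alpha>]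
      by (simp add: ennreal_mult finite_measure.emeasure_eq_measure prob_space.finite_measure)
    then have prod_le': "(\<Prod>i<K. 2 * w i * E) \<le> 2 * measure (series_prior \<alpha> h) (l2_cball f\<^sub>0 (A * real K powr (- \<gamma>)))"
      by (subst (asm) ennreal_le_iff) simp_all
    define k where "k = real K powr (1 + p * m)"
    have kK: "k = real K * (real K powr m) powr p"
      using K by (simp add: k_def powr_add powr_powr mult.commute)
    have "real K \<le> k"
      using powr_mono[of 1 "1 + p * m" "real K"] K m assms by (simp add: k_def)
    have "1 \<le> k" using K \<open>real K \<le> k\<close> by simp
    have Vp: "V powr p \<le> (L + 1) powr p * (real K powr m) powr p"
    proof -
      have "1 \<le> real K powr m"
        using K m by (simp add: ge_one_powr_ge_zero)
      then have "V \<le> (L + 1) * real K powr m"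
        by (simp add: V_def algebra_simps)
      then have "V powr p \<le> ((L + 1) * real K powr m) powr p"
        using assms by (intro powr_mono2) (auto simp: V_def)
      then show ?thesis
        using assms by (simp add: powr_mult)
    qed
    have "exp (- (\<bar>ln (2 * c\<^sub>0)\<bar> * real K)) * exp (- (c\<^sub>1 * V powr p * real K)) * exp (- (1 / 2 + \<alpha>) * real K)
        \<le> (2 * c\<^sub>0) ^ K * exp (- c\<^sub>1 * V powr p) ^ K * (\<Prod>i<K. w i)"
    proof (intro mult_mono)
      have "exp (- \<bar>ln (2 * c\<^sub>0)\<bar>) \<le> exp (ln (2 * c\<^sub>0))" by simp
      then have "exp (- \<bar>ln (2 * c\<^sub>0)\<bar>) ^ K \<le> (2 * c\<^sub>0) ^ K"
        using c by (intro power_mono) auto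
      then show "exp (- (\<bar>ln (2 * c\<^sub>0)\<bar> * real K)) \<le> (2 * c\<^sub>0) ^ K"
        by (simp add: mult.commute flip: exp_of_nat_mult)
      show "exp (- (c\<^sub>1 * V powr p * real K)) \<le> exp (- c\<^sub>1 * V powr p) ^ K"
        by (simp add: mult.commute flip: exp_of_nat_mult)
      show "exp (- (1 / 2 + \<alpha>) * real K) \<le> (\<Prod>i<K. w i)"
        unfolding w_def using assms that by (intro prod_scale_ge) auto
    qed (use c in auto)
    also have "\<dots> = (\<Prod>i<K. 2 * w i * E)"
      by (simp add: E_def prod.distrib power_mult_distrib mult_ac)
    finally have "exp (- (\<bar>ln (2 * c\<^sub>0)\<bar> * real K) + - (c\<^sub>1 * V powr p * real K) + - (1 / 2 + \<alpha>) * real K) \<le> (\<Prod>i<K. 2 * w i * E)"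
      by (simp only: exp_add)
    moreover have "- (C - 1) * k \<le> - (\<bar>ln (2 * c\<^sub>0)\<bar> * real K) + - (c\<^sub>1 * V powr p * real K) + - (1 / 2 + \<alpha>) * real K"
    proof -
      have "\<bar>ln (2 * c\<^sub>0)\<bar> * real K \<le> \<bar>ln (2 * c\<^sub>0)\<bar> * k"
        using \<open>real K \<le> k\<close> by (intro mult_left_mono) auto
      moreover have "(1 / 2 + \<alpha>) * real K \<le> (1 / 2 + \<alpha>) * k"
        using \<open>real K \<le> k\<close> assms by (intro mult_left_mono) auto
      moreover have "c\<^sub>1 * V powr p * real K \<le> c\<^sub>1 * ((L + 1) powr p * (real K powr m) powr p) * real K"
        using Vp c by (intro mult_right_mono mult_left_mono) auto
      then have "c\<^sub>1 * V powr p * real K \<le> c\<^sub>1 * (L + 1) powr p * k"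
        by (simp add: kK mult_ac)
      ultimately show ?thesis
        unfolding C_def by (simp add: algebra_simps)
    qed
    ultimately have "exp (- (C - 1) * k) \<le> 2 * measure (series_prior \<alpha> h) (l2_cball f\<^sub>0 (A * real K powr (- \<gamma>)))"
      using prod_le' by (meson exp_le_cancel_iff order_trans)
    moreover have "exp (- C * k) * 2 \<le> exp (- (C - 1) * k)"
    proof -
      have "2 \<le> exp k"
        using exp_ge_add_one_self[of k] \<open>1 \<le> k\<close> by linarith
      then have "exp (- C * k) * 2 \<le> exp (- C * k) * exp k"
        by (intro mult_left_mono) auto
      then show ?thesis
        by (simp add: algebra_simps flip: exp_add)
    qed
    ultimately show ?thesis
      unfolding k_def by linarith
  qed
  then show ?thesis
    using \<open>A > 0\<close> \<open>C > 0\<close> unfolding m_def \<gamma>_def by blast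
qed

section \<open>The contraction rate\<close>

lemma l2_cball_mono: "r \<le> s \<Longrightarrow> l2_cball f\<^sub>0 r \<subseteq> l2_cball f\<^sub>0 s"
  by (auto simp: l2_cball_def)

theorem theorem1:
  fixes p \<alpha> \<beta> L :: real and f\<^sub>0 :: coeffs and h :: "real \<Rightarrow> real"
  assumes "p > 0" and "\<alpha> > 0" and "\<beta> > 0" and "L > 0"
    and "f\<^sub>0 \<in> hyperrectangle \<beta> L"
    and "prob_density h" and "exp_tails p h"
  shows "\<forall>\<rho>. 0 < \<rho> \<and> \<rho> < 1 \<longrightarrow>
    (\<exists>M>0. (\<lambda>n. LINT X|gauss_seq_law n f\<^sub>0.
        rho_posterior (series_prior \<alpha> h) n \<rho> X (l2_cball f\<^sub>0 (M * rate p \<alpha> \<beta> n)))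
      \<longlonglongrightarrow> 1)"
proof (intro allI impI, elim conjE)
  fix \<rho> :: real assume \<rho>: "0 < \<rho>" "\<rho> < 1"
  define m \<gamma> where "m = max (\<alpha> - \<beta>) 0" and "\<gamma> = min \<alpha> \<beta>"
  \<comment> \<open>The solution of \<open>1 - 2 * \<gamma> * r = r * (1 + p * m)\<close>: for
    \<open>K\<close> of order \<open>n powr r\<close> it balances \<open>n\<close> times the squared
    radius against the cost exponent of the prior mass.\<close>
  define r where "r = 1 / (2 * \<gamma> + p * m + 1)"
  have m0: "m \<ge> 0" and \<gamma>0: "\<gamma> > 0"
    using assms by (simp_all add: m_def \<gamma>_def)
  then have "2 * \<gamma> + p * m + 1 > 0"
    using assms by (intro add_nonneg_pos) auto
  then have r: "r > 0" "r * (2 * \<gamma> + p * m + 1) = 1"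
    by (simp_all add: r_def)
  obtain A C where A: "A > 0" and C: "C > 0"
    and mass: "\<And>K. K \<ge> 1 \<Longrightarrow> exp (- C * real K powr (1 + p * m)) \<le> measure (series_prior \<alpha> h) (l2_cball f\<^sub>0 (A * real K powr (- \<gamma>)))"
    using series_prior_mass[OF assms] unfolding m_def \<gamma>_def by blast
  \<comment> \<open>The common order of both sides of that balance, shown in \<open>nrate\<close> to
    equal \<open>n\<close> times the squared rate.\<close>
  define e where "e n = real n powr (r * (1 + p * m))" for n
  have rate: "rate p \<alpha> \<beta> n = real n powr (- \<gamma> * r)" for n
    by (simp add: rate_def r_def \<gamma>_def m_def min_def max_def)
  have nrate: "real n * (rate p \<alpha> \<beta> n)\<^sup>2 = e n" if "n \<ge> 1" for n
  proof -
    have "real n * (rate p \<alpha> \<beta> n)\<^sup>2 = real n powr (1 + (- \<gamma> * r + - \<gamma> * r))"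
      using that by (simp only: rate powr_add power2_eq_square) simp
    also have "1 + (- \<gamma> * r + - \<gamma> * r) = r * (1 + p * m)"
      using r(2) by (simp add: algebra_simps)
    finally show ?thesis by (simp add: e_def)
  qed
  define C' where "C' = C * 2 powr (1 + p * m)"
  have mass': "exp (- C' * e n) \<le> measure (series_prior \<alpha> h) (l2_cball f\<^sub>0 (A * rate p \<alpha> \<beta> n))" if "n \<ge> 1" for n
  proof -
    interpret prior: prob_space "series_prior \<alpha> h"
      by (rule prob_space_series_prior) fact
    \<comment> \<open>Rounding up keeps the radius below the rate; as \<open>real n powr r\<close>
      is at least 1, it at most doubles the cutoff, which explains the power of 2 in
      \<open>C'\<close>.\<close>
    define K where "K = nat \<lceil>real n powr r\<rceil>"
    have n1: "real n powr r \<ge> 1"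
      using that r by (simp add: ge_one_powr_ge_zero)
    then have K: "real n powr r \<le> real K" "real K \<le> 2 * real n powr r" "K \<ge> 1"
      unfolding K_def by linarith+
    have "real K powr (1 + p * m) \<le> (2 * real n powr r) powr (1 + p * m)"
      using K m0 assms by (intro powr_mono2) auto
    also have "\<dots> = 2 powr (1 + p * m) * e n"
      by (simp add: powr_mult powr_powr e_def)
    finally have "exp (- C' * e n) \<le> exp (- C * real K powr (1 + p * m))"
      using C by (simp add: C'_def)
    also have "\<dots> \<le> measure (series_prior \<alpha> h) (l2_cball f\<^sub>0 (A * real K powr (- \<gamma>)))"
      by (rule mass[OF K(3)])
    also have "\<dots> \<le> measure (series_prior \<alpha> h) (l2_cball f\<^sub>0 (A * rate p \<alpha> \<beta> n))"
    proof (rule prior.finite_measure_mono)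
      have "real K powr (- \<gamma>) \<le> (real n powr r) powr (- \<gamma>)"
        using K n1 \<gamma>0 that by (intro powr_mono2') auto
      then show "l2_cball f\<^sub>0 (A * real K powr (- \<gamma>)) \<subseteq> l2_cball f\<^sub>0 (A * rate p \<alpha> \<beta> n)"
        using A by (intro l2_cball_mono) (simp add: rate powr_powr mult.commute)
      have "l2_cball f\<^sub>0 (A * rate p \<alpha> \<beta> n) \<in> sets seq_space"
        using A by (intro measurable_l2_cball) (simp add: rate)
      then show "l2_cball f\<^sub>0 (A * rate p \<alpha> \<beta> n) \<in> sets (series_prior \<alpha> h)"
        by (simp add: series_prior_def)
    qed
    finally show ?thesis .
  qed
  define \<kappa> where "\<kappa> = \<rho> * (1 - \<rho>) / 2"
  \<comment> \<open>The first two summands bound the growth of the inverse likelihood ratio and the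
    inverse prior mass in units of \<open>e n\<close>; the 1 leaves room for decay. \<open>M\<close>
    is then fixed by \<open>\<kappa> * M\<^sup>2 = 2 * B\<close>.\<close>
  define B where "B = \<rho> * (1 + \<rho>) / 2 * A\<^sup>2 + C' + 1"
  define M where "M = sqrt (2 * B / \<kappa>)"
  have "\<kappa> > 0" using \<rho> by (simp add: \<kappa>_def)
  have "C' > 0" using C by (simp add: C'_def)
  then have "B \<ge> 1" using \<rho> by (simp add: B_def)
  have "M > 0" using \<open>\<kappa> > 0\<close> \<open>B \<ge> 1\<close> by (simp add: M_def)
  have \<kappa>M: "\<kappa> * M\<^sup>2 = 2 * B"
    using \<open>\<kappa> > 0\<close> \<open>B \<ge> 1\<close> by (simp add: M_def)
  define Q where "Q n = (LINT X|gauss_seq_law n f\<^sub>0. rho_posterior (series_prior \<alpha> h) n \<rho> X (l2_cball f\<^sub>0 (M * rate p \<alpha> \<beta> n)))" for n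
  have bounds: "1 - exp (- e n) \<le> Q n \<and> Q n \<le> 1" if "n \<ge> 1" for n
  proof
    \<comment> \<open>This weight splits the decay \<open>2 * B\<close> evenly: the term outside the
      ball becomes \<open>exp (- B * e n)\<close>, and the small-ball term
      \<open>exp ((B - 1) * e n - B * e n)\<close>.\<close>
    define t where "t = exp (B * e n)"
    let ?\<pi> = "measure (series_prior \<alpha> h) (l2_cball f\<^sub>0 (A * rate p \<alpha> \<beta> n))"
    have "e n \<ge> 0" by (simp add: e_def)
    have \<pi>: "exp (- C' * e n) \<le> ?\<pi>" by (rule mass'[OF that])
    then have \<pi>0: "?\<pi> > 0"
      using exp_gt_zero less_le_trans by blast
    have r0: "rate p \<alpha> \<beta> n \<ge> 0" by (simp add: rate)
    have sets: "sets (series_prior \<alpha> h) = sets seq_space"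
      by (simp add: series_prior_def)
    note ball = rho_posterior_ball[OF prob_space_series_prior[OF assms(6)] sets
        hyperrectangle_summable[OF assms(5,3)]
        series_prior_AE_summable[OF assms(6) exp_tails_second_moment[OF assms(6,7)] assms(2)] _ \<rho> _ _ _ \<pi>0,
        of n "M * rate p \<alpha> \<beta> n" t, folded Q_def]
    show "Q n \<le> 1"
      using that A \<open>M > 0\<close> r0 by (intro ball(2)) (simp_all add: t_def)
    have *: "1 - (t * exp (- (\<rho> * (1 - \<rho>) / 2) * (real n * (M * rate p \<alpha> \<beta> n)\<^sup>2))
      + exp (\<rho> * (1 + \<rho>) / 2 * (real n * (A * rate p \<alpha> \<beta> n)\<^sup>2)) / (t * ?\<pi>)) / 2 \<le> Q n"
      using that A \<open>M > 0\<close> r0 by (intro ball(1)) (simp_all add: t_def)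
    have sq: "real n * (x * rate p \<alpha> \<beta> n)\<^sup>2 = x\<^sup>2 * e n" for x
      by (simp add: power_mult_distrib nrate[OF that, symmetric])
    have "t * exp (- (\<rho> * (1 - \<rho>) / 2) * (real n * (M * rate p \<alpha> \<beta> n)\<^sup>2)) = exp (B * e n - (\<kappa> * M\<^sup>2) * e n)"
      unfolding sq t_def \<kappa>_def by (simp add: algebra_simps flip: exp_add)
    also have "\<dots> = exp (- B * e n)"
      unfolding \<kappa>M by (simp add: algebra_simps)
    also have "\<dots> \<le> exp (- e n)"
      using mult_right_mono[OF \<open>B \<ge> 1\<close> \<open>e n \<ge> 0\<close>] by simp
    finally have 1: "t * exp (- (\<rho> * (1 - \<rho>) / 2) * (real n * (M * rate p \<alpha> \<beta> n)\<^sup>2)) \<le> exp (- e n)" .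
    have "exp (\<rho> * (1 + \<rho>) / 2 * (real n * (A * rate p \<alpha> \<beta> n)\<^sup>2)) / (t * ?\<pi>)
        \<le> exp (\<rho> * (1 + \<rho>) / 2 * (A\<^sup>2 * e n)) / (t * exp (- C' * e n))"
      unfolding sq using \<pi> by (intro divide_left_mono mult_left_mono) (simp_all add: t_def \<pi>0)
    also have "\<dots> = exp (\<rho> * (1 + \<rho>) / 2 * (A\<^sup>2 * e n) - (B * e n - C' * e n))"
      unfolding t_def by (simp add: exp_diff flip: exp_add)
    also have "\<dots> = exp (- e n)"
      by (simp add: B_def algebra_simps)
    finally have 2: "exp (\<rho> * (1 + \<rho>) / 2 * (real n * (A * rate p \<alpha> \<beta> n)\<^sup>2)) / (t * ?\<pi>) \<le> exp (- e n)" .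
    have "1 - z \<le> q" if "1 - (x + y) / 2 \<le> q" "x \<le> z" "y \<le> z" for q x y z :: real
      using that by (simp add: field_simps)
    from this[OF * 1 2] show "1 - exp (- e n) \<le> Q n" .
  qed
  have "(\<lambda>n. 1 - exp (- (real n powr s))) \<longlonglongrightarrow> 1" if "s > 0" for s :: real
    using that by real_asymp
  from this[of "r * (1 + p * m)"] have "(\<lambda>n. 1 - exp (- e n)) \<longlonglongrightarrow> 1"
    using r m0 assms by (simp add: e_def add_pos_nonneg)
  then have "Q \<longlonglongrightarrow> 1"
  proof (rule real_tendsto_sandwich[rotated 2])
    show "eventually (\<lambda>n. 1 - exp (- e n) \<le> Q n) sequentially"
      using bounds by (intro eventually_sequentiallyI[of 1]) blast
    show "eventually (\<lambda>n. Q n \<le> 1) sequentially"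
      using bounds by (intro eventually_sequentiallyI[of 1]) blast
  qed simp
  then show "\<exists>M>0. (\<lambda>n. LINT X|gauss_seq_law n f\<^sub>0.
        rho_posterior (series_prior \<alpha> h) n \<rho> X (l2_cball f\<^sub>0 (M * rate p \<alpha> \<beta> n))) \<longlonglongrightarrow> 1"
    using \<open>M > 0\<close> unfolding Q_def by blast
qed

end
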